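(* Let $\tau\ge1$ and $J\ge2$ be integers, let $F_0,F_1$ be continuous distributions on $\mathbb R$ with $\Delta:=|\theta-\frac12|>0$, where $\theta:=\mathbb P(X_0>X_1')$ for independent $X_0\sim F_0$, $X_1'\sim F_1$. Let $(\pi_s)_{s\ge0}$ be deterministic nonnegative weights with $\sum_{s\ge0}\pi_s=1$ and $\pi_\tau>0$, let $(B_t)_{t\ge1}$ be deterministic and positive, and let $\widehat D_R:=\inf\{t\ge1:\widehat M_t^{R,J}>B_t\}$, where $\widehat M^{R,J}_t$ is the restart-mixture KT process. Put $$a_{\tau,m}:=\frac1m\sum_{k=1}^m\frac{\tau}{\tau+k},\qquad \Lambda^R_{\tau,m,J}:=\log B_{\tau+m}+\frac{J-1}{2}\log(m+1)+C_J+\log\frac1{\pi_\tau}.$$ Then for every $m\ge1$, $$\mathbb P_\tau(\widehat D_R>\tau+m)\le\exp\Bigg[-\frac{2m}{7}\Bigg\{\Delta a_{\tau,m}-\frac1{2J}-\sqrt{\frac{[\Lambda^R_{\tau,m,J}]_+}{2m}}\Bigg\}_+^2\Bigg].$$ Consequently, for every post-change monitoring horizon $n\ge1$, $$\mathbb P_\tau(\widehat D_R>\tau+n)\le\inf_{1\le m\le n}\exp\Bigg[-\frac{2m}{7}\Bigg\{\Delta a_{\tau,m}-\frac1{2J}-\sqrt{\frac{[\Lambda^R_{\tau,m,J}]_+}{2m}}\Bigg\}_+^2\Bigg].$$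
   Context: Change-point model (law $\mathbb P_\tau$): $X_1,\ldots,X_\tau$ i.i.d. from $F_0$, $X_{\tau+1},X_{\tau+2},\ldots$ i.i.d. from $F_1$, the two samples independent, $U_1,U_2,\ldots$ i.i.d. $\mathrm{Unif}(0,1)$ independent of the $X$'s, and $$p_t=\frac{\sum_{r=1}^{t-1}\mathbf 1\{X_r>X_t\}+U_t}{t},\qquad t\ge1.$$ Bins: $I_j=[(j-1)/J,j/J)$ for $j=1,\ldots,J-1$ and $I_J=[(J-1)/J,1]$. For $s\ge0$ and $t\ge s$ let $N_j^{(s)}(t):=\sum_{i=s+1}^t\mathbf 1\{p_i\in I_j\}$; for $t>s$ and $u\in I_j$ let $\widehat f_t^{(s,J)}(u):=J\,\dfrac{N_j^{(s)}(t-1)+1/2}{t-s-1+J/2}$. The restarted Krichevsky–Trofimov (KT) component is $\widehat M_t^{(s,J)}:=1$ for $t\le s$ and $\widehat M_t^{(s,J)}:=\prod_{i=s+1}^t\widehat f_i^{(s,J)}(p_i)$ for $t>s$. The restart mixture is $\widehat M_t^{R,J}:=\sum_{s=0}^\infty\pi_s\widehat M_t^{(s,J)}$. Constant $C_J$: for a block $u_1,\ldots,u_N\in[0,1]$ let $M_N^{\mathrm{KT}}(u_{1:N}):=\prod_{\ell=1}^NJ\dfrac{N_{\ell-1,j(u_\ell)}+1/2}{\ell-1+J/2}$, where $j(u)$ is the index of the bin containing $u$ and $N_{\ell-1,j}:=\sum_{r=1}^{\ell-1}\mathbf 1\{u_r\in I_j\}$; let $\widehat{\boldsymbol q}$ be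 the vector of empirical bin frequencies of the block and $\boldsymbol u_J=(1/J,\ldots,1/J)$. $C_J\ge0$ is a constant depending only on $J$ such that $\log M_N^{\mathrm{KT}}(u_{1:N})\ge N D_{\mathrm{KL}}(\widehat{\boldsymbol q}\|\boldsymbol u_J)-\frac{J-1}2\log(N+1)-C_J$ for all $N\ge1$ and all blocks (such a constant exists; natural logarithms). $(x)_+=[x]_+=\max(x,0)$, $\inf\varnothing=\infty$. *)

theory Defs
  imports "HOL-Probability.Probability"
begin

text \<open>
  All sequences of observations, p-values and blocks are functions on \<open>nat\<close> whose entries
  of index \<open>1, 2, \<dots>\<close> are used; the value at index 0 is irrelevant.  Likewise bins are
  numbered \<open>1, \<dots>, J\<close>.
\<close>

definition bin :: "nat \<Rightarrow> nat \<Rightarrow> real set" where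
  "bin J j = (if j = J then {(real J - 1) / real J .. 1}
              else {(real j - 1) / real J ..< real j / real J})"

text \<open>For \<open>J \<ge> 1\<close> and \<open>u\<close> in \<open>[0,1]\<close> this is the unique bin containing \<open>u\<close>; outside \<open>[0,1]\<close>
  it is an unspecified constant, which only matters on a null event below.\<close>

definition bin_index :: "nat \<Rightarrow> real \<Rightarrow> nat" where
  "bin_index J u = (THE j. j \<in> {1..J} \<and> u \<in> bin J j)"

definition bin_count :: "nat \<Rightarrow> (nat \<Rightarrow> real) \<Rightarrow> nat \<Rightarrow> nat \<Rightarrow> nat \<Rightarrow> nat" where
  "bin_count J p s j t = card {i \<in> {s+1..t}. p i \<in> bin J j}"

definition kt_density :: "nat \<Rightarrow> (nat \<Rightarrow> real) \<Rightarrow> nat \<Rightarrow> nat \<Rightarrow> real \<Rightarrow> real" where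
  "kt_density J p s t u =
     real J * ((real (bin_count J p s (bin_index J u) (t - 1)) + 1/2)
               / (real t - real s - 1 + real J / 2))"

definition kt_component :: "nat \<Rightarrow> (nat \<Rightarrow> real) \<Rightarrow> nat \<Rightarrow> nat \<Rightarrow> real" where
  "kt_component J p s t = (if t \<le> s then 1 else \<Prod>i=s+1..t. kt_density J p s i (p i))"

definition restart_mixture :: "nat \<Rightarrow> (nat \<Rightarrow> real) \<Rightarrow> (nat \<Rightarrow> real) \<Rightarrow> nat \<Rightarrow> real" where
  "restart_mixture J \<pi> p t = (\<Sum>s. \<pi> s * kt_component J p s t)"

text \<open>The infimum is taken in \<^typ>\<open>enat\<close>, so that the empty set has infimum \<open>\<infinity>\<close>.\<close>

definition restart_delay :: "nat \<Rightarrow> (nat \<Rightarrow> real) \<Rightarrow> (nat \<Rightarrow> real) \<Rightarrow> (nat \<Rightarrow> real) \<Rightarrow> enat" where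
  "restart_delay J \<pi> B p = Inf (enat ` {t. t \<ge> 1 \<and> restart_mixture J \<pi> p t > B t})"

definition kt_block :: "nat \<Rightarrow> nat \<Rightarrow> (nat \<Rightarrow> real) \<Rightarrow> real" where
  "kt_block J N u =
     (\<Prod>l=1..N. real J * ((real (bin_count J u 0 (bin_index J (u l)) (l - 1)) + 1/2)
                          / (real l - 1 + real J / 2)))"

definition bin_freq :: "nat \<Rightarrow> nat \<Rightarrow> (nat \<Rightarrow> real) \<Rightarrow> nat \<Rightarrow> real" where
  "bin_freq J N u j = real (bin_count J u 0 j N) / real N"

text \<open>The library's \<^const>\<open>KL_divergence\<close> takes the reference measure first: \<open>D(q || r)\<close> is
  \<open>KL_divergence b r q\<close>, with \<open>b\<close> the base of the logarithm.\<close>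

definition kl_vec :: "nat \<Rightarrow> (nat \<Rightarrow> real) \<Rightarrow> (nat \<Rightarrow> real) \<Rightarrow> real" where
  "kl_vec J q r = KL_divergence (exp 1)
     (point_measure {1..J} (\<lambda>j. ennreal (r j))) (point_measure {1..J} (\<lambda>j. ennreal (q j)))"

lemma kl_vec_eq_sum:
  assumes "\<And>j. j \<in> {1..J} \<Longrightarrow> 0 < r j" and "\<And>j. j \<in> {1..J} \<Longrightarrow> 0 \<le> q j"
  shows "kl_vec J q r = (\<Sum>j=1..J. q j * ln (q j / r j))"
proof -
  interpret sigma_finite_measure "count_space {1..J}"
    by (intro sigma_finite_measure_count_space_finite) simp
  have "kl_vec J q r = (\<integral>j. q j * log (exp 1) (q j / r j) \<partial>count_space {1..J})"
    unfolding kl_vec_def point_measure_def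
    using assms by (intro KL_density_density) (fastforce simp: AE_count_space less_imp_le)+
  also have "\<dots> = (\<Sum>j=1..J. q j * ln (q j / r j))"
    by (subst lebesgue_integral_count_space_finite) (simp_all add: log_def)
  finally show ?thesis .
qed

definition kt_regret_constant :: "nat \<Rightarrow> real \<Rightarrow> bool" where
  "kt_regret_constant J C \<longleftrightarrow> C \<ge> 0 \<and>
     (\<forall>N\<ge>1. \<forall>u. (\<forall>l\<in>{1..N}. u l \<in> {0..1}) \<longrightarrow>
        ln (kt_block J N u) \<ge> real N * kl_vec J (bin_freq J N u) (\<lambda>_. 1 / real J)
                               - (real J - 1) / 2 * ln (real N + 1) - C)"

definition conformal_p ::
  "(nat \<Rightarrow> 'a \<Rightarrow> real) \<Rightarrow> (nat \<Rightarrow> 'a \<Rightarrow> real) \<Rightarrow> 'a \<Rightarrow> nat \<Rightarrow> real" where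
  "conformal_p X U \<omega> t = ((\<Sum>r=1..<t. of_bool (X r \<omega> > X t \<omega>)) + U t \<omega>) / real t"

text \<open>The independence requirements of the model (within each of the two samples and within
  the \<open>U\<close>'s, between the two samples, and between the \<open>X\<close>'s and the \<open>U\<close>'s) amount to
  joint independence of the family consisting of all \<open>X i\<close> and all \<open>U i\<close>, \<open>i \<ge> 1\<close>.\<close>

locale change_point_model = prob_space M
  for M :: "'a measure" and X U :: "nat \<Rightarrow> 'a \<Rightarrow> real"
    and F0 F1 :: "real measure" and \<tau> :: nat +
  assumes indep: "indep_vars (\<lambda>_. borel) (case_sum X U) ({1..} <+> {1..})"
    and pre_change: "\<And>i. 1 \<le> i \<Longrightarrow> i \<le> \<tau> \<Longrightarrow> distr M borel (X i) = F0"
    and post_change: "\<And>i. \<tau> < i \<Longrightarrow> distr M borel (X i) = F1"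
    and uniform: "\<And>i. 1 \<le> i \<Longrightarrow> distr M borel (U i) = uniform_measure lborel {0..1}"

definition continuous_distribution :: "real measure \<Rightarrow> bool" where
  "continuous_distribution F \<longleftrightarrow> real_distribution F \<and> (\<forall>x. isCont (cdf F) x)"

definition prob_greater :: "real measure \<Rightarrow> real measure \<Rightarrow> real" where
  "prob_greater F0 F1 = \<P>(z in F0 \<Otimes>\<^sub>M F1. fst z > snd z)"

definition dilution :: "nat \<Rightarrow> nat \<Rightarrow> real" where
  "dilution \<tau> m = 1 / real m * (\<Sum>k=1..m. real \<tau> / (real \<tau> + real k))"

definition restart_threshold ::
  "nat \<Rightarrow> real \<Rightarrow> (nat \<Rightarrow> real) \<Rightarrow> (nat \<Rightarrow> real) \<Rightarrow> nat \<Rightarrow> nat \<Rightarrow> real" where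
  "restart_threshold J C \<pi> B \<tau> m =
     ln (B (\<tau> + m)) + (real J - 1) / 2 * ln (real m + 1) + C + ln (1 / \<pi> \<tau>)"

definition pos_part :: "real \<Rightarrow> real" where
  "pos_part x = max x 0"

definition delay_bound ::
  "nat \<Rightarrow> real \<Rightarrow> (nat \<Rightarrow> real) \<Rightarrow> (nat \<Rightarrow> real) \<Rightarrow> real \<Rightarrow> nat \<Rightarrow> nat \<Rightarrow> real" where
  "delay_bound J C \<pi> B \<Delta> \<tau> m =
     exp (- (2 * real m / 7) *
          (pos_part (\<Delta> * dilution \<tau> m - 1 / (2 * real J)
             - sqrt (pos_part (restart_threshold J C \<pi> B \<tau> m) / (2 * real m))))\<^sup>2)"

end

theory Submission
  imports Defs
begin

text \<open>
  If the mixture has not crossed \<open>B (\<tau> + m)\<close>, neither has its component restarted at \<open>\<tau>\<close>, weighted by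
  \<open>\<pi> \<tau>\<close>.  The regret bound then makes the relative entropy of the bin frequencies of the \<open>m\<close>
  post-change p-values at most \<open>\<Lambda> / m\<close>, and a Pinsker-type inequality forces the mean of these
  p-values to within \<open>1 / (2 * J) + sqrt (\<Lambda> / (2 * m))\<close> of \<open>1 / 2\<close>.  Their expected mean, however,
  is \<open>1 / 2 + (\<theta> - 1 / 2) * a\<close>, since \<open>X t\<close> with \<open>t > \<tau>\<close> is compared with \<open>\<tau>\<close> pre-change observations
  and otherwise with exchangeable ones.  The sum of the p-values is a function of the independent
  observations and randomizers whose squared bounded differences add up to at most
  \<open>7 * m\<close> (pre-change \<open>X\<close>: \<open>m\<close>, post-change \<open>X\<close>: \<open>5 * m\<close>, \<open>U\<close>: \<open>m\<close>), so McDiarmid's inequality bounds the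
  probability of such a deviation.
\<close>

section \<open>McDiarmid's inequality\<close>

text \<open>The values of \<open>h\<close> lie in \<open>[a, a + c]\<close> with \<open>a\<close>
  their infimum, so Hoeffding's lemma applies. Only the width \<open>c\<close> enters the bound, not
  the position of the interval; this matters below, where the interval varies with the remaining
  coordinates.\<close>

lemma (in prob_space) Hoeffding_mgf_oscillation:
  fixes h :: "'a \<Rightarrow> real"
  assumes [measurable]: "h \<in> borel_measurable M"
    and osc: "\<And>x y. x \<in> space M \<Longrightarrow> y \<in> space M \<Longrightarrow> \<bar>h x - h y\<bar> \<le> c"
  shows "(\<integral>\<^sup>+x. ennreal (exp (l * (h x - expectation h))) \<partial>M) \<le> ennreal (exp (l\<^sup>2 * c\<^sup>2 / 8))"
proof -
  have pos: "(\<integral>\<^sup>+x. ennreal (exp (k * (g x - expectation g))) \<partial>M) \<le> ennreal (exp (k\<^sup>2 * c\<^sup>2 / 8))"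
    if [measurable]: "g \<in> borel_measurable M" and "k > 0"
      and g: "\<And>x y. x \<in> space M \<Longrightarrow> y \<in> space M \<Longrightarrow> \<bar>g x - g y\<bar> \<le> c"
    for g :: "'a \<Rightarrow> real" and k
  proof -
    obtain x0 where x0: "x0 \<in> space M"
      using not_empty by blast
    define a where "a = (INF x\<in>space M. g x)"
    have bdd: "bdd_below (g ` space M)"
      using g[OF x0] by (intro bdd_belowI[of _ "g x0 - c"]) (auto simp: abs_le_iff algebra_simps)
    have "a \<le> g x" if "x \<in> space M" for x
      unfolding a_def by (rule cINF_lower[OF bdd that])
    moreover have "g x \<le> a + c" if "x \<in> space M" for x
    proof -
      have "g x - c \<le> a"
        unfolding a_def using g[OF that] x0
        by (intro cINF_greatest) (auto simp: abs_le_iff algebra_simps)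
      thus ?thesis by simp
    qed
    ultimately interpret interval_bounded_random_variable M g a "a + c"
      by unfold_locales auto
    show ?thesis
      using Hoeffdings_lemma_nn_integral[OF \<open>k > 0\<close>] by simp
  qed
  consider "l > 0" | "l = 0" | "l < 0" by linarith
  thus ?thesis
  proof cases
    case 1
    thus ?thesis by (intro pos osc) auto
  next
    case 2
    thus ?thesis by (simp add: emeasure_space_1)
  next
    \<comment> \<open>Negating both \<open>l\<close> and \<open>h\<close> leaves the integrand
      unchanged and makes the parameter positive.\<close>
    case 3
    have "(\<integral>\<^sup>+x. ennreal (exp (- l * (- h x - expectation (\<lambda>x. - h x)))) \<partial>M)
        \<le> ennreal (exp ((- l)\<^sup>2 * c\<^sup>2 / 8))"
      using 3 osc by (intro pos) (auto simp: abs_minus_commute)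
    thus ?thesis by (simp add: algebra_simps)
  qed
qed

text \<open>Induction on the coordinates. Averaging \<open>f\<close> over coordinate
  \<open>i\<close> gives \<open>g\<close>; for fixed other coordinates \<open>f - g\<close> is
  centred with oscillation at most \<open>c i\<close>, which contributes the factor
  \<open>exp (l^2 * (c i)^2 / 8)\<close>. The average \<open>g\<close> inherits \<open>K\<close> and
  the constants \<open>c j\<close>, so the induction hypothesis applies to it. The bound
  \<open>K\<close> provides integrability and does not enter the estimate.\<close>

lemma (in product_prob_space) McDiarmid_mgf:
  fixes f :: "('i \<Rightarrow> 'a) \<Rightarrow> real"
  assumes "finite I" and "f \<in> borel_measurable (Pi\<^sub>M I M)"
    and "\<And>x. x \<in> space (Pi\<^sub>M I M) \<Longrightarrow> \<bar>f x\<bar> \<le> K"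
    and "\<And>i x y. i \<in> I \<Longrightarrow> x \<in> space (Pi\<^sub>M I M) \<Longrightarrow> y \<in> space (M i)
           \<Longrightarrow> \<bar>f (x(i := y)) - f x\<bar> \<le> c i"
  shows "(\<integral>\<^sup>+x. ennreal (exp (l * (f x - integral\<^sup>L (Pi\<^sub>M I M) f))) \<partial>Pi\<^sub>M I M)
           \<le> ennreal (exp (l\<^sup>2 * (\<Sum>i\<in>I. (c i)\<^sup>2) / 8))"
  using assms
proof (induction I arbitrary: f rule: finite_induct)
  case empty
  thus ?case by (simp add: PiM_empty nn_integral_count_space_finite lebesgue_integral_count_space_finite)
next
  case (insert i I)
  note [measurable] = insert.prems(1)
  note bound = insert.prems(2) and diff = insert.prems(3)
  interpret I: prob_space "Pi\<^sub>M I M"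
    by (intro prob_space_PiM) (rule prob_space)
  interpret II: prob_space "Pi\<^sub>M (insert i I) M"
    by (intro prob_space_PiM) (rule prob_space)
  define g where "g x = (\<integral>y. f (x(i := y)) \<partial>M i)" for x
  define \<mu> where "\<mu> = integral\<^sup>L (Pi\<^sub>M (insert i I) M) f"
  have upd: "x(i := y) \<in> space (Pi\<^sub>M (insert i I) M)"
    if "x \<in> space (Pi\<^sub>M I M)" "y \<in> space (M i)" for x y
    using that by (auto simp: space_PiM PiE_iff extensional_def)
  have meas2 [measurable]: "(\<lambda>(x, y). f (x(i := y))) \<in> borel_measurable (Pi\<^sub>M I M \<Otimes>\<^sub>M M i)"
    by measurable
  have measy [measurable]: "(\<lambda>y. f (x(i := y))) \<in> borel_measurable (M i)"
    if "x \<in> space (Pi\<^sub>M I M)" for x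
    using measurable_compose[OF measurable_Pair1'[OF that] meas2] by simp
  have inty: "integrable (M i) (\<lambda>y. f (x(i := y)))" if "x \<in> space (Pi\<^sub>M I M)" for x
    using that bound upd by (intro M.integrable_const_bound[where B = K]) auto
  have g_meas [measurable]: "g \<in> borel_measurable (Pi\<^sub>M I M)"
    unfolding g_def using meas2 by (intro M.borel_measurable_lebesgue_integral) simp
  have g_bound: "\<bar>g x\<bar> \<le> K" if "x \<in> space (Pi\<^sub>M I M)" for x
  proof -
    have "\<bar>g x\<bar> \<le> (\<integral>y. \<bar>f (x(i := y))\<bar> \<partial>M i)"
      unfolding g_def by (rule integral_abs_bound)
    also have "\<dots> \<le> (\<integral>y. K \<partial>M i)"
      using that bound upd inty[OF that] by (intro integral_mono) auto
    finally show ?thesis by (simp add: M.prob_space)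
  qed
  have g_diff: "\<bar>g (x(j := z)) - g x\<bar> \<le> c j"
    if j: "j \<in> I" and x: "x \<in> space (Pi\<^sub>M I M)" and z: "z \<in> space (M j)" for j x z
  proof -
    have x': "x(j := z) \<in> space (Pi\<^sub>M I M)"
      using j x z by (auto simp: space_PiM PiE_iff extensional_def)
    have ij: "i \<noteq> j" using j insert.hyps by auto
    have "\<bar>g (x(j := z)) - g x\<bar> = \<bar>\<integral>y. f (x(j := z, i := y)) - f (x(i := y)) \<partial>M i\<bar>"
      unfolding g_def using inty[OF x] inty[OF x'] by simp
    also have "\<dots> \<le> (\<integral>y. \<bar>f (x(j := z, i := y)) - f (x(i := y))\<bar> \<partial>M i)"
      by (rule integral_abs_bound)
    also have "\<dots> \<le> (\<integral>y. c j \<partial>M i)"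
    proof (intro integral_mono)
      \<comment> \<open>The updates at \<open>i\<close> and \<open>j\<close> commute, so this is a
        change of coordinate \<open>j\<close> at the point \<open>x(i := y)\<close>.\<close>
      fix y assume "y \<in> space (M i)"
      thus "\<bar>f (x(j := z, i := y)) - f (x(i := y))\<bar> \<le> c j"
        unfolding fun_upd_twist[OF ij[symmetric]] by (intro diff upd x) (use j z in auto)
    qed (use inty[OF x] inty[OF x'] in auto)
    finally show ?thesis by (simp add: M.prob_space)
  qed
  have "integrable (Pi\<^sub>M (insert i I) M) f"
    using bound by (intro II.integrable_const_bound[where B = K]) auto
  hence \<mu>: "\<mu> = integral\<^sup>L (Pi\<^sub>M I M) g"
    unfolding \<mu>_def g_def by (rule product_integral_insert[OF insert.hyps])
  have "(\<integral>\<^sup>+x. ennreal (exp (l * (f x - \<mu>))) \<partial>Pi\<^sub>M (insert i I) M)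
      = (\<integral>\<^sup>+x. (\<integral>\<^sup>+y. ennreal (exp (l * (f (x(i := y)) - \<mu>))) \<partial>M i) \<partial>Pi\<^sub>M I M)"
    by (rule product_nn_integral_insert[OF insert.hyps]) simp
  also have "\<dots> \<le> (\<integral>\<^sup>+x. ennreal (exp (l\<^sup>2 * (c i)\<^sup>2 / 8)) * ennreal (exp (l * (g x - \<mu>))) \<partial>Pi\<^sub>M I M)"
  proof (rule nn_integral_mono)
    fix x assume x: "x \<in> space (Pi\<^sub>M I M)"
    note [measurable] = measy[OF x]
    have "(\<integral>\<^sup>+y. ennreal (exp (l * (f (x(i := y)) - \<mu>))) \<partial>M i)
        = (\<integral>\<^sup>+y. ennreal (exp (l * (f (x(i := y)) - g x))) * ennreal (exp (l * (g x - \<mu>))) \<partial>M i)"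
      by (simp add: ennreal_mult[symmetric] exp_add[symmetric] algebra_simps)
    also have "\<dots> = (\<integral>\<^sup>+y. ennreal (exp (l * (f (x(i := y)) - g x))) \<partial>M i)
                      * ennreal (exp (l * (g x - \<mu>)))"
      by (rule nn_integral_multc) simp
    also have "\<dots> \<le> ennreal (exp (l\<^sup>2 * (c i)\<^sup>2 / 8)) * ennreal (exp (l * (g x - \<mu>)))"
    proof (rule mult_right_mono)
      show "(\<integral>\<^sup>+y. ennreal (exp (l * (f (x(i := y)) - g x))) \<partial>M i)
              \<le> ennreal (exp (l\<^sup>2 * (c i)\<^sup>2 / 8))"
        unfolding g_def
      proof (rule M.Hoeffding_mgf_oscillation)
        fix y z assume yz: "y \<in> space (M i)" "z \<in> space (M i)"
        show "\<bar>f (x(i := y)) - f (x(i := z))\<bar> \<le> c i"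
          using diff[OF insertI1 upd[OF x yz(2)] yz(1)] by (simp only: fun_upd_upd)
      qed simp
    qed simp
    finally show "(\<integral>\<^sup>+y. ennreal (exp (l * (f (x(i := y)) - \<mu>))) \<partial>M i)
        \<le> ennreal (exp (l\<^sup>2 * (c i)\<^sup>2 / 8)) * ennreal (exp (l * (g x - \<mu>)))" .
  qed
  also have "\<dots> = ennreal (exp (l\<^sup>2 * (c i)\<^sup>2 / 8))
                   * (\<integral>\<^sup>+x. ennreal (exp (l * (g x - \<mu>))) \<partial>Pi\<^sub>M I M)"
    by (rule nn_integral_cmult) simp
  also have "\<dots> \<le> ennreal (exp (l\<^sup>2 * (c i)\<^sup>2 / 8)) * ennreal (exp (l\<^sup>2 * (\<Sum>i\<in>I. (c i)\<^sup>2) / 8))"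
    unfolding \<mu> by (intro mult_left_mono insert.IH g_meas g_bound g_diff) auto
  also have "\<dots> = ennreal (exp (l\<^sup>2 * (\<Sum>i\<in>insert i I. (c i)\<^sup>2) / 8))"
    using insert.hyps
    by (simp add: ennreal_mult[symmetric] exp_add[symmetric] algebra_simps add_divide_distrib)
  finally show ?case unfolding \<mu>_def .
qed

lemma (in product_prob_space) McDiarmid_PiM:
  fixes f :: "('i \<Rightarrow> 'a) \<Rightarrow> real"
  assumes "finite I" and [measurable]: "f \<in> borel_measurable (Pi\<^sub>M I M)"
    and "\<And>x. x \<in> space (Pi\<^sub>M I M) \<Longrightarrow> \<bar>f x\<bar> \<le> K"
    and "\<And>i x y. i \<in> I \<Longrightarrow> x \<in> space (Pi\<^sub>M I M) \<Longrightarrow> y \<in> space (M i)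
           \<Longrightarrow> \<bar>f (x(i := y)) - f x\<bar> \<le> c i"
    and V: "(\<Sum>i\<in>I. (c i)\<^sup>2) \<le> V" "V > 0" and "\<epsilon> > 0"
  shows "measure (Pi\<^sub>M I M) {x \<in> space (Pi\<^sub>M I M). f x - integral\<^sup>L (Pi\<^sub>M I M) f \<ge> \<epsilon>}
           \<le> exp (- 2 * \<epsilon>\<^sup>2 / V)"
proof -
  \<comment> \<open>Minimizer of \<open>l^2 * V / 8 - l * \<epsilon>\<close>; the minimum is
    \<open>- 2 * \<epsilon>^2 / V\<close>.\<close>
  define l where "l = 4 * \<epsilon> / V"
  have l: "l > 0" using V \<open>\<epsilon> > 0\<close> by (simp add: l_def)
  let ?P = "Pi\<^sub>M I M" and ?\<mu> = "integral\<^sup>L (Pi\<^sub>M I M) f"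
  have "ennreal (measure ?P {x \<in> space ?P. f x - ?\<mu> \<ge> \<epsilon>}) = emeasure ?P {x \<in> space ?P. f x - ?\<mu> \<ge> \<epsilon>}"
    by (simp add: P.emeasure_eq_measure)
  also have "\<dots> \<le> ennreal (exp (- l * \<epsilon>)) * (\<integral>\<^sup>+x\<in>space ?P. ennreal (exp (l * (f x - ?\<mu>))) \<partial>?P)"
    by (intro Chernoff_ineq_nn_integral_ge l) auto
  also have "(\<integral>\<^sup>+x\<in>space ?P. ennreal (exp (l * (f x - ?\<mu>))) \<partial>?P)
      = (\<integral>\<^sup>+x. ennreal (exp (l * (f x - ?\<mu>))) \<partial>?P)"
    by (intro nn_integral_cong) simp
  also have "ennreal (exp (- l * \<epsilon>)) * \<dots>
      \<le> ennreal (exp (- l * \<epsilon>)) * ennreal (exp (l\<^sup>2 * (\<Sum>i\<in>I. (c i)\<^sup>2) / 8))"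
    by (intro mult_left_mono McDiarmid_mgf[where K = K]) (use assms in auto)
  also have "\<dots> = ennreal (exp (l\<^sup>2 * (\<Sum>i\<in>I. (c i)\<^sup>2) / 8 - l * \<epsilon>))"
    by (simp add: ennreal_mult[symmetric] exp_add[symmetric])
  also have "\<dots> \<le> ennreal (exp (l\<^sup>2 * V / 8 - l * \<epsilon>))"
    using V by (intro ennreal_leI) (auto intro!: mult_left_mono)
  also have "l\<^sup>2 * V / 8 - l * \<epsilon> = - 2 * \<epsilon>\<^sup>2 / V"
    using V by (simp add: l_def field_simps power2_eq_square)
  finally show ?thesis by simp
qed

text \<open>By independence the joint law of the family is the product of its marginals, so the
  inequality for product measures can be pulled back to \<open>M\<close>.\<close>

lemma (in prob_space) McDiarmid_ge:
  fixes f :: "('i \<Rightarrow> 'b) \<Rightarrow> real" and Z :: "'i \<Rightarrow> 'a \<Rightarrow> 'b"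
  assumes "finite I" and "I \<noteq> {}" and Z: "indep_vars N Z I"
    and [measurable]: "f \<in> borel_measurable (Pi\<^sub>M I N)"
    and bound: "\<And>x. x \<in> space (Pi\<^sub>M I N) \<Longrightarrow> \<bar>f x\<bar> \<le> K"
    and diff: "\<And>i x y. i \<in> I \<Longrightarrow> x \<in> space (Pi\<^sub>M I N) \<Longrightarrow> y \<in> space (N i)
           \<Longrightarrow> \<bar>f (x(i := y)) - f x\<bar> \<le> c i"
    and V: "(\<Sum>i\<in>I. (c i)\<^sup>2) \<le> V" "V > 0" and "\<epsilon> > 0"
  defines "F \<equiv> \<lambda>\<omega>. f (\<lambda>i\<in>I. Z i \<omega>)"
  shows "prob {\<omega> \<in> space M. F \<omega> - expectation F \<ge> \<epsilon>} \<le> exp (- 2 * \<epsilon>\<^sup>2 / V)"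
proof -
  have Z_meas [measurable]: "Z i \<in> measurable M (N i)" if "i \<in> I" for i
    using Z that unfolding indep_vars_def by blast
  \<comment> \<open>A product probability space needs a probability measure at every index, so a
    point mass fills the indices outside \<open>I\<close>.\<close>
  define D where "D i = (if i \<in> I then distr M (N i) (Z i) else return (count_space UNIV) undefined)"
    for i
  interpret D: prob_space "D i" for i
    unfolding D_def by (auto intro!: prob_space_distr prob_space_return)
  interpret PD: product_prob_space D I by unfold_locales
  have "distr M (Pi\<^sub>M I N) (\<lambda>\<omega>. \<lambda>i\<in>I. Z i \<omega>) = (\<Pi>\<^sub>M i\<in>I. distr M (N i) (Z i))"
    using indep_vars_iff_distr_eq_PiM'[OF \<open>I \<noteq> {}\<close> Z_meas] Z by simp
  also have "\<dots> = Pi\<^sub>M I D"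
    by (intro PiM_cong) (auto simp: D_def)
  finally have distr: "Pi\<^sub>M I D = distr M (Pi\<^sub>M I N) (\<lambda>\<omega>. \<lambda>i\<in>I. Z i \<omega>)" ..
  have sp: "space (Pi\<^sub>M I D) = space (Pi\<^sub>M I N)"
    unfolding distr by simp
  have f_D: "f \<in> borel_measurable (Pi\<^sub>M I D)"
    unfolding distr by simp
  have F: "expectation F = integral\<^sup>L (Pi\<^sub>M I D) f"
    unfolding distr F_def by (subst integral_distr) auto
  have Z_PiM: "(\<lambda>\<omega>. \<lambda>i\<in>I. Z i \<omega>) \<in> measurable M (Pi\<^sub>M I N)"
    by simp
  have "prob {\<omega> \<in> space M. F \<omega> - expectation F \<ge> \<epsilon>}
      = measure (Pi\<^sub>M I D) {x \<in> space (Pi\<^sub>M I D). f x - integral\<^sup>L (Pi\<^sub>M I D) f \<ge> \<epsilon>}"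
    unfolding F unfolding distr
    by (subst measure_distr)
       (auto simp: F_def measurable_space[OF Z_PiM] intro!: arg_cong[where f = prob])
  also have "\<dots> \<le> exp (- 2 * \<epsilon>\<^sup>2 / V)"
    using diff by (intro PD.McDiarmid_PiM[OF \<open>finite I\<close> f_D _ _ V \<open>\<epsilon> > 0\<close>, where K = K])
      (auto simp: sp bound D_def)
  finally show ?thesis .
qed

section \<open>Relative entropy and harmonic sums\<close>

text \<open>Gibbs variational principle: the \<open>q\<close>-mean of a function is at most the
  relative entropy plus the logarithm of the function's uniform exponential moment. For
  \<open>4 * d * (f - \<mu>)\<close> that moment is at most \<open>exp (2 * d^2)\<close> by
  Hoeffding's lemma, whence \<open>4 * d^2 <= KL + 2 * d^2\<close>.\<close>

lemma weighted_mean_deviation_le_KL: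
  fixes q f :: "nat \<Rightarrow> real"
  assumes "J \<ge> 1"
    and q: "\<And>j. j \<in> {1..J} \<Longrightarrow> q j \<ge> 0" "(\<Sum>j=1..J. q j) = 1"
    and f: "\<And>j. j \<in> {1..J} \<Longrightarrow> f j \<in> {0..1}"
  shows "2 * ((\<Sum>j=1..J. q j * f j) - (\<Sum>j=1..J. f j) / real J)\<^sup>2
           \<le> (\<Sum>j=1..J. q j * ln (q j / (1 / real J)))"
proof -
  define \<mu> where "\<mu> = (\<Sum>j=1..J. f j) / real J"
  define d where "d = (\<Sum>j=1..J. q j * f j) - \<mu>"
  \<comment> \<open>\<open>Z\<close> normalizes the uniform law tilted by
    \<open>exp (4 * d * (f j - \<mu>))\<close>. The slope \<open>4 * d\<close> maximizes
    \<open>l * d - l^2 / 8\<close> over \<open>l\<close>.\<close>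
  define Z where "Z = (\<Sum>j=1..J. exp (4 * d * (f j - \<mu>))) / real J"
  have J: "real J > 0" "{1..J} \<noteq> {}" using \<open>J \<ge> 1\<close> by auto
  have Z_pos: "Z > 0"
    unfolding Z_def using J by (intro divide_pos_pos sum_pos) auto
  have "Z \<le> exp (2 * d\<^sup>2)"
  proof -
    let ?U = "uniform_count_measure {1..J}"
    interpret U: prob_space ?U
      using J by (intro prob_space_uniform_count_measure) auto
    have \<mu>: "\<mu> = U.expectation f"
      unfolding \<mu>_def using J by (simp add: integral_uniform_count_measure)
    have "Z = U.expectation (\<lambda>j. exp (4 * d * (f j - \<mu>)))"
      unfolding Z_def using J by (simp add: integral_uniform_count_measure)
    also have "ennreal \<dots> = (\<integral>\<^sup>+j. ennreal (exp (4 * d * (f j - \<mu>))) \<partial>?U)"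
      unfolding uniform_count_measure_def
      by (intro nn_integral_eq_integral[symmetric] integrable_point_measure_finite) auto
    also have "\<dots> \<le> ennreal (exp ((4 * d)\<^sup>2 * 1\<^sup>2 / 8))"
      unfolding \<mu>
    proof (rule U.Hoeffding_mgf_oscillation)
      show "f \<in> borel_measurable ?U"
        by (simp add: uniform_count_measure_def)
    next
      fix i j assume "i \<in> space ?U" "j \<in> space ?U"
      thus "\<bar>f i - f j\<bar> \<le> 1"
        using f[of i] f[of j] by (simp add: space_uniform_count_measure abs_le_iff)
    qed
    finally show ?thesis by (simp add: power_mult_distrib)
  qed
  have "(\<Sum>j=1..J. q j * (4 * d * (f j - \<mu>)) - q j * ln (q j / (1 / real J)) - q j * ln Z) \<le> (\<Sum>j=1..J. exp (4 * d * (f j - \<mu>)) / (real J * Z) - q j)"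
  proof (rule sum_mono)
    fix j assume j: "j \<in> {1..J}"
    show "q j * (4 * d * (f j - \<mu>)) - q j * ln (q j / (1 / real J)) - q j * ln Z
        \<le> exp (4 * d * (f j - \<mu>)) / (real J * Z) - q j"
    proof (cases "q j = 0")
      \<comment> \<open>With zero weight the left side vanishes, as \<open>0 * ln 0 = 0\<close>, and
        the right side is nonnegative.\<close>
      case True
      thus ?thesis using J Z_pos by simp
    next
      case False
      hence qj: "q j > 0" using q(1)[OF j] by simp
      \<comment> \<open>\<open>w\<close> is the tilted law divided by \<open>q\<close> at
        \<open>j\<close>. After weighting \<open>ln w <= w - 1\<close> by \<open>q j\<close>, the
        right sides sum to zero because both laws have total mass 1.\<close>
      define w where "w = exp (4 * d * (f j - \<mu>)) / (real J * Z * q j)"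
      have w: "w > 0" using J Z_pos qj by (simp add: w_def)
      have "ln w = 4 * d * (f j - \<mu>) - ln (q j / (1 / real J)) - ln Z"
        using J Z_pos qj by (simp add: w_def ln_div ln_mult)
      hence "4 * d * (f j - \<mu>) - ln (q j / (1 / real J)) - ln Z \<le> w - 1"
        using ln_le_minus_one[OF w] by simp
      from mult_left_mono[OF this, of "q j"] qj
      show ?thesis by (simp add: w_def algebra_simps)
    qed
  qed
  also have "\<dots> = 0"
    using J Z_pos[THEN less_imp_neq, symmetric] q(2) by (simp add: sum_subtractf sum_divide_distrib[symmetric] Z_def)
  finally have "(\<Sum>j=1..J. q j * (4 * d * (f j - \<mu>))) - (\<Sum>j=1..J. q j * ln (q j / (1 / real J)))
      - (\<Sum>j=1..J. q j) * ln Z \<le> 0"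
    by (simp add: sum_subtractf sum_distrib_right)
  moreover have "(\<Sum>j=1..J. q j * (4 * d * (f j - \<mu>))) = 4 * d * d"
  proof -
    have "(\<Sum>j=1..J. q j * (4 * d * (f j - \<mu>)))
        = 4 * d * ((\<Sum>j=1..J. q j * f j) - (\<Sum>j=1..J. q j) * \<mu>)"
      by (simp add: sum_distrib_left sum_distrib_right sum_subtractf[symmetric] algebra_simps)
    thus ?thesis using q(2) by (simp add: d_def)
  qed
  ultimately have "4 * d * d - ln Z \<le> (\<Sum>j=1..J. q j * ln (q j / (1 / real J)))"
    using q(2) by simp
  moreover have "ln Z \<le> 2 * d\<^sup>2"
    using \<open>Z \<le> exp (2 * d\<^sup>2)\<close> Z_pos ln_le_cancel_iff[of Z "exp (2 * d\<^sup>2)"] by simp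
  ultimately have "2 * d\<^sup>2 \<le> (\<Sum>j=1..J. q j * ln (q j / (1 / real J)))"
    by (simp add: power2_eq_square)
  thus ?thesis
    unfolding d_def \<mu>_def .
qed

text \<open>Cauchy-Schwarz against the constant 1, with the sum of \<open>1 / t^2\<close> beyond
  \<open>\<tau>\<close> bounded by \<open>1 / \<tau>\<close> through telescoping. The left side is
  the joint contribution of the \<open>\<tau>\<close> pre-change observations to the squared
  differences.\<close>

lemma harmonic_tail_square:
  fixes \<tau> m :: nat
  assumes "\<tau> \<ge> 1"
  shows "real \<tau> * (\<Sum>t=\<tau>+1..\<tau>+m. 1 / real t)\<^sup>2 \<le> real m"
proof -
  have "(\<Sum>t=\<tau>+1..\<tau>+m. 1 / (real t)\<^sup>2) \<le> 1 / real \<tau> - 1 / real (\<tau> + m)"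
  proof (induction m)
    case (Suc m)
    define a where "a = real (\<tau> + m)"
    have a: "a > 0" using assms by (simp add: a_def)
    have "1 / (a + 1)\<^sup>2 \<le> 1 / (a * (a + 1))"
      using a by (intro divide_left_mono) (auto simp: power2_eq_square)
    also have "\<dots> = 1 / a - 1 / (a + 1)"
      using a by (simp add: field_simps)
    finally have "1 / (a + 1)\<^sup>2 \<le> 1 / a - 1 / (a + 1)" .
    thus ?case using Suc.IH by (simp add: a_def add.commute)
  qed simp
  hence *: "(\<Sum>t=\<tau>+1..\<tau>+m. 1 / (real t)\<^sup>2) \<le> 1 / real \<tau>"
    by (rule order_trans) simp
  have "(\<Sum>t=\<tau>+1..\<tau>+m. 1 / real t)\<^sup>2
      \<le> (\<Sum>t=\<tau>+1..\<tau>+m. 1 / (real t)\<^sup>2) * real m"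
    using Cauchy_Schwarz_ineq_sum[of "\<lambda>t. 1 / real t" "\<lambda>_. 1" "{\<tau>+1..\<tau>+m}"]
    by (simp add: power_one_over)
  also have "\<dots> \<le> 1 / real \<tau> * real m"
    using * by (intro mult_right_mono) auto
  finally show ?thesis using assms by (simp add: field_simps)
qed

text \<open>With \<open>d t = 1 + (\<Sum>k=t+1..n. 1 / k)\<close>, so that \<open>d (t - 1) = d t + 1 / t\<close>, the
  quantity \<open>t * (d t)\<^sup>2 + 2 * t * d t + 2 * t\<close> increases by at least \<open>(d t)\<^sup>2\<close> from \<open>t - 1\<close> to \<open>t\<close>.\<close>

lemma harmonic_tail_sum_squares:
  fixes \<tau> m :: nat
  shows "(\<Sum>t=\<tau>+1..\<tau>+m. (1 + (\<Sum>k=t+1..\<tau>+m. 1 / real k))\<^sup>2) \<le> 5 * real m"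
proof -
  define n where "n = \<tau> + m"
  define d where "d t = 1 + (\<Sum>k=t+1..n. 1 / real k)" for t
  have d_ge: "d t \<ge> 1" for t
    unfolding d_def by (simp add: sum_nonneg)
  have dstep: "d t = d (Suc t) + 1 / real (Suc t)" if "t < n" for t
    unfolding d_def using that by (simp add: sum.atLeast_Suc_atMost)
  have "\<tau> \<le> n" by (simp add: n_def)
  \<comment> \<open>Downward induction from \<open>n\<close>. Since \<open>d n = 1\<close>, the
    potential equals \<open>5 * n\<close> there, which is the origin of the constant 5.\<close>
  have "(\<Sum>t=\<tau>+1..n. (d t)\<^sup>2)
      \<le> 5 * real n - 2 * real \<tau> - 2 * real \<tau> * d \<tau> - real \<tau> * (d \<tau>)\<^sup>2"
    using \<open>\<tau> \<le> n\<close>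
  proof (induction rule: inc_induct)
    case base
    show ?case by (simp add: d_def)
  next
    case (step t)
    define s e where "s = real (Suc t)" and "e = d (Suc t)"
    have s: "s > 0" "real t = s - 1" and e: "e \<ge> 1"
      using d_ge by (auto simp: s_def e_def)
    have dt: "d t = e + 1 / s" unfolding s_def e_def by (rule dstep[OF step.hyps(2)])
    \<comment> \<open>This is exactly the amount by which the increase of the potential exceeds
      \<open>e^2\<close>.\<close>
    have "0 \<le> 2 * e / s + 1 / s + 1 / s\<^sup>2" using s e by simp
    also have "\<dots> = - (s - 1) * (e + 1 / s)\<^sup>2 - 2 * (s - 1) - 2 * (s - 1) * (e + 1 / s)
        - (e\<^sup>2 - s * e\<^sup>2 - 2 * s - 2 * s * e)"
      using s by (simp add: field_simps power2_eq_square)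
    finally have "e\<^sup>2 + (5 * real n - 2 * s - 2 * s * e - s * e\<^sup>2)
        \<le> 5 * real n - 2 * (s - 1) - 2 * (s - 1) * (e + 1 / s) - (s - 1) * (e + 1 / s)\<^sup>2"
      by (simp add: algebra_simps)
    moreover have "(\<Sum>r=t+1..n. (d r)\<^sup>2) = e\<^sup>2 + (\<Sum>r=Suc t+1..n. (d r)\<^sup>2)"
      using step.hyps by (simp add: sum.atLeast_Suc_atMost e_def)
    ultimately show ?case
      using step.IH unfolding dt s(2) s_def[symmetric] e_def[symmetric] by linarith
  qed
  \<comment> \<open>Since \<open>d \<tau> >= 1\<close>, the three subtracted terms amount to at
    least \<open>5 * \<tau>\<close>, and \<open>n - \<tau> = m\<close>.\<close>
  moreover have "real \<tau> \<le> real \<tau> * d \<tau>" "real \<tau> \<le> real \<tau> * (d \<tau>)\<^sup>2"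
    using d_ge[of \<tau>] by (auto intro: mult_left_le simp: mult_le_cancel_left1)
  ultimately have "(\<Sum>t=\<tau>+1..n. (d t)\<^sup>2) \<le> 5 * real m"
    by (simp add: n_def)
  thus ?thesis unfolding d_def n_def .
qed

section \<open>The sum of the post-change p-values\<close>

lemma conformal_p_in_unit_interval:
  assumes "t \<ge> 1" and "U t \<omega> \<in> {0..1}"
  shows "conformal_p X U \<omega> t \<in> {0..1}"
proof -
  have "(\<Sum>r=1..<t. of_bool (X r \<omega> > X t \<omega>) :: real) \<le> real (card {1..<t}) * 1"
    by (rule sum_bounded_above) simp
  moreover have "(\<Sum>r=1..<t. of_bool (X r \<omega> > X t \<omega>) :: real) \<ge> 0"
    by (simp add: sum_nonneg)
  ultimately show ?thesis
    using assms by (auto simp: conformal_p_def field_simps)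
qed

text \<open>The coordinate \<open>Inl r\<close> stands for \<open>X r\<close>, the coordinate \<open>Inr t\<close> for \<open>U t\<close>.  The latter is
  clamped to \<open>[0,1]\<close> so that the differences are bounded everywhere and not only almost everywhere.\<close>

definition post_change_sum :: "nat \<Rightarrow> nat \<Rightarrow> (nat + nat \<Rightarrow> real) \<Rightarrow> real" where
  "post_change_sum \<tau> m x = (\<Sum>t=\<tau>+1..\<tau>+m.
     conformal_p (\<lambda>r x. x (Inl r)) (\<lambda>t x. max 0 (min 1 (x (Inr t)))) x t)"

text \<open>Bounded-difference constants of \<open>post_change_sum\<close>. A changed observation
  flips at most one comparison in each later p-value, costing \<open>1 / t\<close>; a post-change
  one also moves its own p-value, which is controlled by the range \<open>[0,1]\<close> and costs 1.
  A randomizer affects a single p-value.\<close>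

definition influence :: "nat \<Rightarrow> nat \<Rightarrow> nat + nat \<Rightarrow> real" where
  "influence \<tau> m i = (case i of
       Inl r \<Rightarrow> if r \<le> \<tau> then \<Sum>t=\<tau>+1..\<tau>+m. 1 / real t else 1 + (\<Sum>t=r+1..\<tau>+m. 1 / real t)
     | Inr t \<Rightarrow> 1 / real t)"

text \<open>All observations up to \<open>\<tau> + m\<close> enter the ranks, whereas a randomizer
  enters only at its own time.\<close>

abbreviation post_change_index :: "nat \<Rightarrow> nat \<Rightarrow> (nat + nat) set" where
  "post_change_index \<tau> m \<equiv> {1..\<tau>+m} <+> {\<tau>+1..\<tau>+m}"

lemma sum_influence_squares_le:
  assumes "\<tau> \<ge> 1"
  shows "(\<Sum>i\<in>post_change_index \<tau> m. (influence \<tau> m i)\<^sup>2) \<le> 7 * real m"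
proof -
  have "(\<Sum>i\<in>post_change_index \<tau> m. (influence \<tau> m i)\<^sup>2)
      = (\<Sum>r=1..\<tau>+m. (influence \<tau> m (Inl r))\<^sup>2) + (\<Sum>t=\<tau>+1..\<tau>+m. (influence \<tau> m (Inr t))\<^sup>2)"
    by (subst sum.Plus) auto
  also have "(\<Sum>r=1..\<tau>+m. (influence \<tau> m (Inl r))\<^sup>2)
      = (\<Sum>r=1..\<tau>. (influence \<tau> m (Inl r))\<^sup>2) + (\<Sum>r=\<tau>+1..\<tau>+m. (influence \<tau> m (Inl r))\<^sup>2)"
    by (intro sum.ub_add_nat) simp
  also have "(\<Sum>r=1..\<tau>. (influence \<tau> m (Inl r))\<^sup>2) = real \<tau> * (\<Sum>t=\<tau>+1..\<tau>+m. 1 / real t)\<^sup>2"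
    by (simp add: influence_def)
  also have "(\<Sum>r=\<tau>+1..\<tau>+m. (influence \<tau> m (Inl r))\<^sup>2)
      = (\<Sum>r=\<tau>+1..\<tau>+m. (1 + (\<Sum>t=r+1..\<tau>+m. 1 / real t))\<^sup>2)"
    by (intro sum.cong) (auto simp: influence_def)
  \<comment> \<open>The crude estimate \<open>1 / t <= 1\<close> gives the last unit in
    \<open>7 = 1 + 5 + 1\<close>.\<close>
  also have "(\<Sum>t=\<tau>+1..\<tau>+m. (influence \<tau> m (Inr t))\<^sup>2) \<le> (\<Sum>t=\<tau>+1..\<tau>+m. 1)"
    by (intro sum_mono) (auto simp: influence_def power_le_one)
  finally show ?thesis
    using harmonic_tail_square[OF assms, of m] harmonic_tail_sum_squares[of \<tau> m] by simp
qed

lemma post_change_sum_diff: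
  assumes "i \<in> post_change_index \<tau> m"
  shows "\<bar>post_change_sum \<tau> m (x(i := y)) - post_change_sum \<tau> m x\<bar> \<le> influence \<tau> m i"
proof -
  define p where "p x t = conformal_p (\<lambda>r x. x (Inl r)) (\<lambda>t x. max 0 (min 1 (x (Inr t)))) x t"
    for x :: "nat + nat \<Rightarrow> real" and t
  have p01: "p x t \<in> {0..1}" if "t \<ge> 1" for x t
    unfolding p_def using that by (intro conformal_p_in_unit_interval) auto
  have le: "\<bar>post_change_sum \<tau> m (x(i := y)) - post_change_sum \<tau> m x\<bar>
      \<le> (\<Sum>t=\<tau>+1..\<tau>+m. \<bar>p (x(i := y)) t - p x t\<bar>)"
    unfolding post_change_sum_def p_def[symmetric] sum_subtractf[symmetric] by (rule sum_abs)
  from assms consider r where "i = Inl r" "r \<in> {1..\<tau>+m}" | s where "i = Inr s" "s \<in> {\<tau>+1..\<tau>+m}"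
    by auto
  thus ?thesis
  proof cases
    case 1
    define w where "w t = (if t < r then 0 else if t = r then 1 else 1 / real t)" for t
    have "\<bar>p (x(i := y)) t - p x t\<bar> \<le> w t" if t: "t \<in> {\<tau>+1..\<tau>+m}" for t
    proof -
      consider "t < r" | "t = r" | "t > r" by linarith
      thus ?thesis
      proof cases
        assume "t < r"
        hence "p (x(i := y)) t = p x t"
          unfolding p_def conformal_p_def 1 by (auto intro!: sum.cong)
        thus ?thesis by (simp add: w_def \<open>t < r\<close>)
      next
        \<comment> \<open>Every comparison may flip here, so the range of the p-value is
          used.\<close>
        assume "t = r"
        thus ?thesis
          using p01[of t x] p01[of t "x(i := y)"] t by (simp add: w_def abs_le_iff)
      next
        assume "t > r"
        \<comment> \<open>At a later time the threshold \<open>x (Inl t)\<close> is unchanged, so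
          only the summand \<open>s = r\<close> can differ.\<close>
        let ?d = "\<lambda>s. of_bool ((x(i := y)) (Inl s) > x (Inl t)) - of_bool (x (Inl s) > x (Inl t)) :: real"
        have "\<bar>p (x(i := y)) t - p x t\<bar> = \<bar>\<Sum>s=1..<t. ?d s\<bar> / real t"
          using \<open>t > r\<close>
          by (simp add: p_def conformal_p_def 1 sum_subtractf diff_divide_distrib[symmetric])
        also have "\<bar>\<Sum>s=1..<t. ?d s\<bar> \<le> (\<Sum>s=1..<t. \<bar>?d s\<bar>)"
          by (rule sum_abs)
        also have "\<dots> \<le> (\<Sum>s=1..<t. of_bool (s = r))"
          by (intro sum_mono) (auto simp: 1)
        also have "\<dots> \<le> 1"
          by (simp add: of_bool_def sum.delta)
        finally show ?thesis
          using \<open>t > r\<close> by (simp add: w_def divide_right_mono)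
      qed
    qed
    hence "(\<Sum>t=\<tau>+1..\<tau>+m. \<bar>p (x(i := y)) t - p x t\<bar>) \<le> (\<Sum>t=\<tau>+1..\<tau>+m. w t)"
      by (rule sum_mono)
    also have "\<dots> = influence \<tau> m i"
    proof (cases "r \<le> \<tau>")
      case True
      thus ?thesis
        by (auto simp: influence_def 1 w_def intro!: sum.cong)
    next
      case False
      have "(\<Sum>t=\<tau>+1..\<tau>+m. w t) = (\<Sum>t=r..\<tau>+m. w t)"
        using False by (intro sum.mono_neutral_right) (auto simp: w_def)
      also have "\<dots> = 1 + (\<Sum>t=r+1..\<tau>+m. w t)"
        using 1 by (simp add: sum.atLeast_Suc_atMost w_def)
      also have "(\<Sum>t=r+1..\<tau>+m. w t) = (\<Sum>t=r+1..\<tau>+m. 1 / real t)"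
        by (intro sum.cong) (auto simp: w_def)
      finally show ?thesis
        using False by (simp add: influence_def 1)
    qed
    finally show ?thesis using le by linarith
  next
    case 2
    \<comment> \<open>Clamped randomizers lie in \<open>[0,1]\<close>, so the numerator changes by
      at most 1.\<close>
    have "\<bar>p (x(i := y)) t - p x t\<bar> \<le> (if t = s then 1 / real t else 0)"
      if "t \<in> {\<tau>+1..\<tau>+m}" for t
      by (auto simp: p_def conformal_p_def 2 diff_divide_distrib[symmetric] intro!: divide_right_mono)
    hence "(\<Sum>t=\<tau>+1..\<tau>+m. \<bar>p (x(i := y)) t - p x t\<bar>)
        \<le> (\<Sum>t=\<tau>+1..\<tau>+m. if t = s then 1 / real t else 0)"
      by (rule sum_mono)
    also have "\<dots> = influence \<tau> m i"
      using 2 by (simp add: influence_def sum.delta)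
    finally show ?thesis using le by linarith
  qed
qed

lemma abs_post_change_sum_le: "\<bar>post_change_sum \<tau> m x\<bar> \<le> real m"
proof -
  have *: "conformal_p (\<lambda>r x. x (Inl r)) (\<lambda>t x. max 0 (min 1 (x (Inr t)))) x t \<in> {0..1}"
    if "t \<in> {\<tau>+1..\<tau>+m}" for t
    using that by (intro conformal_p_in_unit_interval) auto
  have "\<bar>post_change_sum \<tau> m x\<bar> \<le> real (card {\<tau>+1..\<tau>+m}) * 1"
    unfolding post_change_sum_def
    by (rule order_trans[OF sum_abs sum_bounded_above]) (use * in auto)
  thus ?thesis by simp
qed

lemma post_change_sum_measurable:
  "post_change_sum \<tau> m \<in> borel_measurable (Pi\<^sub>M (post_change_index \<tau> m) (\<lambda>_. borel))"
  unfolding post_change_sum_def conformal_p_def of_bool_def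
  by (intro borel_measurable_sum borel_measurable_divide borel_measurable_add measurable_If
        borel_measurable_const borel_measurable_max borel_measurable_min
        borel_measurable_less measurable_component_singleton) auto

text \<open>The clamp is the identity under this hypothesis, which holds almost surely in the
  model.\<close>

lemma post_change_sum_restrict:
  assumes "\<And>t. t \<in> {\<tau>+1..\<tau>+m} \<Longrightarrow> U t \<omega> \<in> {0..1}"
  shows "post_change_sum \<tau> m (\<lambda>i\<in>post_change_index \<tau> m. case_sum X U i \<omega>)
           = (\<Sum>t=\<tau>+1..\<tau>+m. conformal_p X U \<omega> t)"
  unfolding post_change_sum_def conformal_p_def
  using assms by (intro sum.cong refl arg_cong2[where f = "(/)"] arg_cong2[where f = "(+)"]) auto

section \<open>Probabilities of pairwise comparisons\<close>

lemma sets_pair_order: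
  shows "{z :: real \<times> real. fst z > snd z} \<in> sets (borel \<Otimes>\<^sub>M borel)"
    and "{z :: real \<times> real. fst z < snd z} \<in> sets (borel \<Otimes>\<^sub>M borel)"
    and "{z :: real \<times> real. fst z = snd z} \<in> sets (borel \<Otimes>\<^sub>M borel)"
proof -
  have "{z \<in> space (borel \<Otimes>\<^sub>M borel). fst z > (snd z :: real)} \<in> sets (borel \<Otimes>\<^sub>M borel)"
    "{z \<in> space (borel \<Otimes>\<^sub>M borel). fst z < (snd z :: real)} \<in> sets (borel \<Otimes>\<^sub>M borel)"
    "{z \<in> space (borel \<Otimes>\<^sub>M borel). fst z = (snd z :: real)} \<in> sets (borel \<Otimes>\<^sub>M borel)"
    by measurable
  thus "{z :: real \<times> real. fst z > snd z} \<in> sets (borel \<Otimes>\<^sub>M borel)"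
    "{z :: real \<times> real. fst z < snd z} \<in> sets (borel \<Otimes>\<^sub>M borel)"
    "{z :: real \<times> real. fst z = snd z} \<in> sets (borel \<Otimes>\<^sub>M borel)"
    by (simp_all add: space_pair_measure)
qed

lemma (in prob_space) prob_gt_indep_var:
  fixes Y Z :: "'a \<Rightarrow> real"
  assumes "indep_var borel Y borel Z"
  shows "prob {\<omega> \<in> space M. Y \<omega> > Z \<omega>} = prob_greater (distr M borel Y) (distr M borel Z)"
proof -
  have [measurable]: "Y \<in> borel_measurable M" "Z \<in> borel_measurable M"
    and eq: "distr M borel Y \<Otimes>\<^sub>M distr M borel Z = distr M (borel \<Otimes>\<^sub>M borel) (\<lambda>\<omega>. (Y \<omega>, Z \<omega>))"
    using assms by (simp_all add: indep_var_distribution_eq)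
  show ?thesis
    unfolding prob_greater_def eq
    by (subst measure_distr) (auto simp: space_pair_measure sets_pair_order intro!: arg_cong[where f = prob])
qed

lemma (in prob_space) indep_var_of_indep_vars:
  assumes "indep_vars N Z I" "i \<in> I" "j \<in> I" "i \<noteq> j"
  shows "indep_var (N i) (Z i) (N j) (Z j)"
proof -
  have "indep_var (N i) ((\<lambda>x. x i) \<circ> (\<lambda>\<omega>. restrict (\<lambda>i. Z i \<omega>) {i}))
                  (N j) ((\<lambda>x. x j) \<circ> (\<lambda>\<omega>. restrict (\<lambda>i. Z i \<omega>) {j}))"
    using assms by (intro indep_var_compose[OF indep_var_restrict[OF assms(1), of "{i}" "{j}"]]) auto
  thus ?thesis by (simp add: comp_def)
qed

text \<open>Swapping coordinates gives both strict orders the same mass. The diagonal is null by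
  Fubini: its sections are singletons, which have no mass under a continuous
  \<open>F\<close>.\<close>

lemma prob_greater_self:
  assumes "continuous_distribution F"
  shows "prob_greater F F = 1 / 2"
proof -
  interpret F: real_distribution F
    using assms by (simp add: continuous_distribution_def)
  interpret P: pair_prob_space F F ..
  have sp: "space (F \<Otimes>\<^sub>M F) = UNIV" by (simp add: space_pair_measure)
  let ?G = "{z :: real \<times> real. fst z > snd z}" and ?L = "{z :: real \<times> real. fst z < snd z}"
    and ?E = "{z :: real \<times> real. fst z = snd z}"
  have sets: "?G \<in> sets (F \<Otimes>\<^sub>M F)" "?L \<in> sets (F \<Otimes>\<^sub>M F)" "?E \<in> sets (F \<Otimes>\<^sub>M F)"
    using sets_pair_order by (simp_all cong: sets_pair_measure_cong)
  have "emeasure (F \<Otimes>\<^sub>M F) ?E = (\<integral>\<^sup>+x. emeasure F (Pair x -` ?E) \<partial>F)"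
    by (rule F.emeasure_pair_measure_alt[OF sets(3)])
  also have "\<dots> = (\<integral>\<^sup>+x. 0 \<partial>F)"
  proof (rule nn_integral_cong)
    fix x :: real
    have "Pair x -` ?E = {x}" by auto
    moreover have "measure F {x} = 0"
      using assms by (simp add: continuous_distribution_def F.isCont_cdf[symmetric])
    ultimately show "emeasure F (Pair x -` ?E) = 0"
      by (simp add: F.emeasure_eq_measure)
  qed
  finally have E: "measure (F \<Otimes>\<^sub>M F) ?E = 0"
    by (simp add: measure_def)
  have "measure (F \<Otimes>\<^sub>M F) ?G = measure (distr (F \<Otimes>\<^sub>M F) (F \<Otimes>\<^sub>M F) (\<lambda>(x, y). (y, x))) ?G"
    using P.distr_pair_swap by simp
  also have "\<dots> = measure (F \<Otimes>\<^sub>M F) ?L"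
    using sets by (subst measure_distr) (auto simp: sp intro!: arg_cong[where f = "measure (F \<Otimes>\<^sub>M F)"])
  finally have GL: "measure (F \<Otimes>\<^sub>M F) ?G = measure (F \<Otimes>\<^sub>M F) ?L" .
  have "1 = measure (F \<Otimes>\<^sub>M F) (?G \<union> (?L \<union> ?E))"
  proof -
    have "?G \<union> (?L \<union> ?E) = UNIV" by auto
    thus ?thesis using P.prob_space unfolding sp by simp
  qed
  also have "\<dots> = measure (F \<Otimes>\<^sub>M F) ?G + (measure (F \<Otimes>\<^sub>M F) ?L + measure (F \<Otimes>\<^sub>M F) ?E)"
    using sets by (subst P.finite_measure_Union) (auto intro!: P.finite_measure_Union)
  finally show ?thesis
    unfolding prob_greater_def sp using GL E by simp
qed

section \<open>Measurability and means of the p-values\<close>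

context change_point_model
begin

lemma X_measurable: "i \<ge> 1 \<Longrightarrow> X i \<in> borel_measurable M"
  and U_measurable: "i \<ge> 1 \<Longrightarrow> U i \<in> borel_measurable M"
  using indep unfolding indep_vars_def by (force dest: bspec[of _ _ "Inl i"] bspec[of _ _ "Inr i"])+

lemma conformal_p_measurable:
  assumes "t \<ge> 1"
  shows "(\<lambda>\<omega>. conformal_p X U \<omega> t) \<in> borel_measurable M"
proof -
  note [measurable] = X_measurable U_measurable
  show ?thesis
    unfolding conformal_p_def of_bool_def using assms
    by (intro borel_measurable_sum borel_measurable_divide borel_measurable_add measurable_If
          borel_measurable_const borel_measurable_less) auto
qed

lemma AE_uniform:
  assumes "t \<ge> 1"
  shows "AE \<omega> in M. U t \<omega> \<in> {0..1}"
proof -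
  note [measurable] = U_measurable[OF assms]
  have "AE u in distr M borel (U t). u \<in> {0..1}"
    unfolding uniform[OF assms] by (intro AE_uniform_measureI) auto
  thus ?thesis by (subst (asm) AE_distr_iff) auto
qed

lemma expectation_uniform:
  assumes "t \<ge> 1"
  shows "expectation (U t) = 1 / 2"
proof -
  \<comment> \<open>Only the sigma-algebra of the target matters to \<open>distr\<close>, so
    \<open>lborel\<close> can serve as target and as reference measure of the density.\<close>
  have "distr M lborel (U t) = distr M borel (U t)"
    by (rule distr_cong) auto
  also have "\<dots> = density lborel (\<lambda>x. ennreal (indicator {0..1} x / measure lborel {0..1::real}))"
    unfolding uniform[OF assms] uniform_measure_def
    by (intro arg_cong[where f = "density lborel"] ext) (simp add: indicator_def)
  finally have "distributed M lborel (U t) (\<lambda>x. ennreal (indicator {0..1} x / measure lborel {0..1::real}))"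
    using U_measurable[OF assms] by (auto simp: distributed_def)
  from uniform_distributed_expectation[OF this] show ?thesis by simp
qed

lemma prob_gt_X:
  assumes "1 \<le> r" "1 \<le> t" "r \<noteq> t"
  shows "prob {\<omega> \<in> space M. X r \<omega> > X t \<omega>} = prob_greater (distr M borel (X r)) (distr M borel (X t))"
  using indep_var_of_indep_vars[OF indep, of "Inl r" "Inl t"] assms
  by (intro prob_gt_indep_var) auto

text \<open>Each of the \<open>\<tau>\<close> pre-change comparisons has probability \<theta>, each
  of the \<open>t - \<tau> - 1\<close> post-change ones 1/2 by symmetry. The mean 1/2 of the
  randomizer completes the numerator to \<open>\<tau> * \<theta> + (t - \<tau>) / 2\<close>.\<close>

lemma expectation_conformal_p:
  assumes "continuous_distribution F1" and "\<tau> < t"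
  shows "expectation (\<lambda>\<omega>. conformal_p X U \<omega> t)
           = 1 / 2 + (prob_greater F0 F1 - 1 / 2) * (real \<tau> / real t)"
proof -
  note [measurable] = X_measurable U_measurable
  have t: "t \<ge> 1" using \<open>\<tau> < t\<close> by simp
  have int: "integrable M (\<lambda>\<omega>. of_bool (X r \<omega> > X t \<omega>) :: real)" if "r \<in> {1..<t}" for r
    using that t unfolding of_bool_def
    by (intro integrable_const_bound[where B = 1] measurable_If borel_measurable_less) auto
  have intU: "integrable M (U t)"
    using t by (intro integrable_const_bound[where B = 1] eventually_mono[OF AE_uniform]) auto
  have E: "expectation (\<lambda>\<omega>. of_bool (X r \<omega> > X t \<omega>)) = prob {\<omega> \<in> space M. X r \<omega> > X t \<omega>}" for r
  proof -
    have "expectation (\<lambda>\<omega>. of_bool (X r \<omega> > X t \<omega>))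
        = expectation (\<lambda>\<omega>. indicator {\<omega> \<in> space M. X r \<omega> > X t \<omega>} \<omega>)"
      by (intro Bochner_Integration.integral_cong) (auto simp: indicator_def)
    also have "\<dots> = prob ({\<omega> \<in> space M. X r \<omega> > X t \<omega>} \<inter> space M)"
      by (rule Bochner_Integration.integral_indicator)
    also have "{\<omega> \<in> space M. X r \<omega> > X t \<omega>} \<inter> space M = {\<omega> \<in> space M. X r \<omega> > X t \<omega>}"
      by auto
    finally show ?thesis .
  qed
  have "expectation (\<lambda>\<omega>. conformal_p X U \<omega> t)
      = expectation (\<lambda>\<omega>. (\<Sum>r=1..<t. of_bool (X r \<omega> > X t \<omega>)) + U t \<omega>) / real t"
    unfolding conformal_p_def by (rule Bochner_Integration.integral_divide_zero)
  also have "expectation (\<lambda>\<omega>. (\<Sum>r=1..<t. of_bool (X r \<omega> > X t \<omega>)) + U t \<omega>)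
      = expectation (\<lambda>\<omega>. \<Sum>r=1..<t. of_bool (X r \<omega> > X t \<omega>)) + expectation (U t)"
    by (intro Bochner_Integration.integral_add Bochner_Integration.integrable_sum int intU)
  also have "expectation (\<lambda>\<omega>. \<Sum>r=1..<t. of_bool (X r \<omega> > X t \<omega>))
      = (\<Sum>r=1..<t. prob {\<omega> \<in> space M. X r \<omega> > X t \<omega>})"
    unfolding E[symmetric] by (intro Bochner_Integration.integral_sum int)
  also have "expectation (U t) = 1 / 2"
    by (rule expectation_uniform[OF t])
  also have "(\<Sum>r=1..<t. prob {\<omega> \<in> space M. X r \<omega> > X t \<omega>})
      = (\<Sum>r=1..<t. if r \<le> \<tau> then prob_greater F0 F1 else 1 / 2)"
    using \<open>\<tau> < t\<close> t
    by (intro sum.cong) (auto simp: prob_gt_X pre_change post_change prob_greater_self assms)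
  also have "\<dots> = (\<Sum>r=1..\<tau>. prob_greater F0 F1) + (\<Sum>r=\<tau>+1..<t. 1 / 2)"
  proof -
    have *: "{1..<t} = {1..\<tau>} \<union> {\<tau>+1..<t}" using \<open>\<tau> < t\<close> by auto
    show ?thesis unfolding * by (subst sum.union_disjoint) auto
  qed
  also have "\<dots> = real \<tau> * prob_greater F0 F1 + (real t - real \<tau> - 1) / 2"
    using \<open>\<tau> < t\<close> by (simp add: of_nat_diff)
  finally show ?thesis
    using t by (simp add: field_simps)
qed

end

section \<open>The probability of a late detection\<close>

text \<open>The sign \<open>\<sigma>\<close> lets one upper-tail inequality serve both directions.
  \<open>A\<close> need not be measurable: it is enclosed in the deviation event of \<open>F\<close>
  together with the null set \<open>N\<close>, and monotonicity asks only for the larger set to be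
  measurable.\<close>

lemma (in change_point_model) post_change_sum_tail:
  fixes \<sigma> :: real
  assumes "\<tau> \<ge> 1" "m \<ge> 1" "\<epsilon> > 0" and \<sigma>: "\<bar>\<sigma>\<bar> = 1"
    and "continuous_distribution F1"
    and A: "\<And>\<omega>. \<omega> \<in> A \<Longrightarrow> \<omega> \<in> space M"
      "\<And>\<omega>. \<omega> \<in> A \<Longrightarrow> (\<And>t. t \<in> {\<tau>+1..\<tau>+m} \<Longrightarrow> U t \<omega> \<in> {0..1}) \<Longrightarrow>
         \<sigma> * ((\<Sum>t=\<tau>+1..\<tau>+m. conformal_p X U \<omega> t)
           - real m * (1 / 2 + (prob_greater F0 F1 - 1 / 2) * dilution \<tau> m)) \<ge> \<epsilon>"
  shows "prob A \<le> exp (- 2 * \<epsilon>\<^sup>2 / (7 * real m))"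
proof -
  let ?I = "post_change_index \<tau> m"
  note [measurable] = U_measurable
  define F where "F \<omega> = \<sigma> * post_change_sum \<tau> m (\<lambda>i\<in>?I. case_sum X U i \<omega>)" for \<omega>
  have indep': "indep_vars (\<lambda>_. borel) (case_sum X U) ?I"
    by (rule indep_vars_subset[OF indep]) auto
  have rv [measurable]: "(\<lambda>\<omega>. \<lambda>i\<in>?I. case_sum X U i \<omega>) \<in> measurable M (Pi\<^sub>M ?I (\<lambda>_. borel))"
    using indep' unfolding indep_vars_def by (intro measurable_restrict) auto
  have F_meas [measurable]: "F \<in> borel_measurable M"
    unfolding F_def
    by (intro borel_measurable_times borel_measurable_const
          measurable_compose[OF rv post_change_sum_measurable])
  have U01: "AE \<omega> in M. \<forall>t\<in>{\<tau>+1..\<tau>+m}. U t \<omega> \<in> {0..1}"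
    by (intro AE_finite_allI AE_uniform) auto
  have p_int: "integrable M (\<lambda>\<omega>. conformal_p X U \<omega> t)" if "t \<in> {\<tau>+1..\<tau>+m}" for t
  proof (rule integrable_const_bound[where B = 1])
    show "AE \<omega> in M. norm (conformal_p X U \<omega> t) \<le> 1"
      using U01 by eventually_elim (use that conformal_p_in_unit_interval[of t U _ X] in force)
  qed (use that in \<open>auto intro: conformal_p_measurable\<close>)
  \<comment> \<open>The clamped functional and the sum of p-values agree almost surely, hence have
    the same mean.\<close>
  have "expectation F = expectation (\<lambda>\<omega>. \<sigma> * (\<Sum>t=\<tau>+1..\<tau>+m. conformal_p X U \<omega> t))"
  proof (rule integral_cong_AE)
    show "AE \<omega> in M. F \<omega> = \<sigma> * (\<Sum>t=\<tau>+1..\<tau>+m. conformal_p X U \<omega> t)"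
      using U01 unfolding F_def by eventually_elim (subst post_change_sum_restrict, auto)
  qed (auto intro!: borel_measurable_times borel_measurable_sum conformal_p_measurable)
  also have "\<dots> = \<sigma> * (\<Sum>t=\<tau>+1..\<tau>+m. 1 / 2 + (prob_greater F0 F1 - 1 / 2) * (real \<tau> / real t))"
    using p_int by (simp add: expectation_conformal_p assms)
  also have "(\<Sum>t=\<tau>+1..\<tau>+m. 1 / 2 + (prob_greater F0 F1 - 1 / 2) * (real \<tau> / real t))
      = real m / 2 + (prob_greater F0 F1 - 1 / 2) * (\<Sum>t=\<tau>+1..\<tau>+m. real \<tau> / real t)"
    by (simp add: sum.distrib sum_distrib_left)
  also have "(\<Sum>t=\<tau>+1..\<tau>+m. real \<tau> / real t) = real m * dilution \<tau> m"
  proof -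
    have "(\<Sum>t=\<tau>+1..\<tau>+m. real \<tau> / real t) = (\<Sum>k=1..m. real \<tau> / (real \<tau> + real k))"
      by (rule sum.reindex_bij_witness[of _ "\<lambda>k. \<tau> + k" "\<lambda>t. t - \<tau>"]) auto
    thus ?thesis using \<open>m \<ge> 1\<close> by (simp add: dilution_def)
  qed
  finally have EF: "expectation F
      = \<sigma> * (real m * (1 / 2 + (prob_greater F0 F1 - 1 / 2) * dilution \<tau> m))"
    by (simp add: algebra_simps)
  define N where "N = {\<omega> \<in> space M. \<exists>t\<in>{\<tau>+1..\<tau>+m}. U t \<omega> \<notin> {0..1}}"
  have N [measurable]: "N \<in> sets M"
  proof -
    have "N = (\<Union>t\<in>{\<tau>+1..\<tau>+m}. {\<omega> \<in> space M. U t \<omega> \<notin> {0..1}})" by (auto simp: N_def)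
    also have "\<dots> \<in> sets M"
      by (intro sets.finite_UN) measurable
    finally show ?thesis .
  qed
  have "prob N = 0"
  proof -
    have "AE \<omega> in M. \<omega> \<notin> N" using U01 by eventually_elim (auto simp: N_def)
    thus ?thesis by (simp add: prob_eq_0)
  qed
  have "A \<subseteq> {\<omega> \<in> space M. F \<omega> - expectation F \<ge> \<epsilon>} \<union> N"
  proof
    fix \<omega> assume "\<omega> \<in> A"
    show "\<omega> \<in> {\<omega> \<in> space M. F \<omega> - expectation F \<ge> \<epsilon>} \<union> N"
    proof (cases "\<forall>t\<in>{\<tau>+1..\<tau>+m}. U t \<omega> \<in> {0..1}")
      case True
      hence "F \<omega> = \<sigma> * (\<Sum>t=\<tau>+1..\<tau>+m. conformal_p X U \<omega> t)"
        unfolding F_def by (subst post_change_sum_restrict) auto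
      thus ?thesis
        using A(2)[OF \<open>\<omega> \<in> A\<close>] A(1)[OF \<open>\<omega> \<in> A\<close>] True by (simp add: EF right_diff_distrib)
    next
      case False
      thus ?thesis using A(1)[OF \<open>\<omega> \<in> A\<close>] by (auto simp: N_def)
    qed
  qed
  hence "prob A \<le> prob ({\<omega> \<in> space M. F \<omega> - expectation F \<ge> \<epsilon>} \<union> N)"
    by (intro finite_measure_mono) auto
  also have "\<dots> \<le> prob {\<omega> \<in> space M. F \<omega> - expectation F \<ge> \<epsilon>} + prob N"
    by (intro measure_Un_le) auto
  also have "\<dots> = prob {\<omega> \<in> space M. F \<omega> - expectation F \<ge> \<epsilon>}"
    using \<open>prob N = 0\<close> by simp
  also have "\<dots> \<le> exp (- 2 * \<epsilon>\<^sup>2 / (7 * real m))"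
    unfolding F_def
  proof (rule McDiarmid_ge[where K = "real m" and c = "influence \<tau> m"])
    show "(\<lambda>x. \<sigma> * post_change_sum \<tau> m x) \<in> borel_measurable (Pi\<^sub>M ?I (\<lambda>_. borel))"
      by (intro borel_measurable_times borel_measurable_const post_change_sum_measurable)
    show "\<bar>\<sigma> * post_change_sum \<tau> m x\<bar> \<le> real m" for x
      using abs_post_change_sum_le[of \<tau> m x] \<sigma> by (simp add: abs_mult)
    show "\<bar>\<sigma> * post_change_sum \<tau> m (x(i := y)) - \<sigma> * post_change_sum \<tau> m x\<bar> \<le> influence \<tau> m i"
      if "i \<in> ?I" for i x y
      using post_change_sum_diff[OF that, of x y] \<sigma>
      by (simp add: abs_mult right_diff_distrib[symmetric])
    show "(\<Sum>i\<in>?I. (influence \<tau> m i)\<^sup>2) \<le> 7 * real m"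
      by (rule sum_influence_squares_le[OF \<open>\<tau> \<ge> 1\<close>])
  qed (use assms indep' in auto)
  finally show ?thesis .
qed

section \<open>Bins and block means\<close>

lemma bin_partition:
  assumes "J \<ge> 1" and "u \<in> {0..1}"
  obtains k where "k \<in> {1..J}" "\<And>j. j \<in> {1..J} \<Longrightarrow> u \<in> bin J j \<longleftrightarrow> j = k"
    "\<bar>u - (real k - 1 / 2) / real J\<bar> \<le> 1 / (2 * real J)"
proof -
  have J: "real J > 0" using \<open>J \<ge> 1\<close> by simp
  define v where "v = real J * u"
  have v: "0 \<le> v" "v \<le> real J"
    using assms J by (auto simp: v_def intro: mult_left_le)
  have mem: "u \<in> bin J j \<longleftrightarrow> real j - 1 \<le> v \<and> (v < real j \<or> j = J)" if "j \<in> {1..J}" for j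
    using J that assms by (auto simp: bin_def v_def field_simps)
  \<comment> \<open>At \<open>u = 1\<close> the floor alone would give \<open>J + 1\<close>; the
    minimum puts this point into the closed last bin.\<close>
  define k where "k = min J (nat \<lfloor>v\<rfloor> + 1)"
  have k: "k \<in> {1..J}" using \<open>J \<ge> 1\<close> by (auto simp: k_def)
  have "real (nat \<lfloor>v\<rfloor>) \<le> v" "v < real (nat \<lfloor>v\<rfloor>) + 1"
    using v by linarith+
  hence kv: "real k - 1 \<le> v" "v < real k \<or> k = J"
    unfolding k_def min_def by (auto split: if_splits simp del: of_nat_nat) linarith
  have "u \<in> bin J j \<longleftrightarrow> j = k" if j: "j \<in> {1..J}" for j
  proof
    assume "u \<in> bin J j"
    hence jv: "real j - 1 \<le> v" "v < real j \<or> j = J" using mem[OF j] by auto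
    show "j = k"
    proof (rule ccontr)
      assume "j \<noteq> k"
      then consider "j < k" | "k < j" by linarith
      thus False
      proof cases
        case 1
        hence "j \<noteq> J" "real j + 1 \<le> real k" using k by auto
        thus False using jv kv by linarith
      next
        case 2
        hence "k \<noteq> J" "real k + 1 \<le> real j" using j by auto
        thus False using jv kv by linarith
      qed
    qed
  qed (use mem[OF k] kv in simp)
  moreover have "\<bar>u - (real k - 1 / 2) / real J\<bar> \<le> 1 / (2 * real J)"
  proof -
    have "v \<le> real k" using kv v by auto
    hence "\<bar>v - (real k - 1 / 2)\<bar> \<le> 1 / 2" using kv(1) by linarith
    moreover have "u - (real k - 1 / 2) / real J = (v - (real k - 1 / 2)) / real J"
      using J by (simp add: v_def field_simps)
    ultimately show ?thesis
      using J by (simp add: abs_divide field_simps)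
  qed
  ultimately show thesis using that k by blast
qed

text \<open>Replacing each \<open>u l\<close> by the midpoint of its bin moves the mean by at most
  half a bin width. The mean of the midpoints is their average under the bin frequencies, their
  uniform average is 1/2, and the entropy inequality compares the two.\<close>

lemma block_mean_deviation_le_KL:
  assumes "J \<ge> 1" and "N \<ge> 1" and u: "\<And>l. l \<in> {1..N} \<Longrightarrow> u l \<in> {0..1}"
  shows "\<bar>(\<Sum>l=1..N. u l) / real N - 1 / 2\<bar>
           \<le> 1 / (2 * real J) + sqrt (kl_vec J (bin_freq J N u) (\<lambda>_. 1 / real J) / 2)"
proof -
  define q where "q = bin_freq J N u"
  define mid where "mid j = (real j - 1 / 2) / real J" for j :: nat
  have J: "real J > 0" and N: "real N > 0" using assms by auto
  have "\<exists>k. \<forall>l\<in>{1..N}. k l \<in> {1..J} \<and> (\<forall>j\<in>{1..J}. u l \<in> bin J j \<longleftrightarrow> j = k l)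
      \<and> \<bar>u l - mid (k l)\<bar> \<le> 1 / (2 * real J)"
    unfolding mid_def by (intro bchoice) (metis bin_partition[OF \<open>J \<ge> 1\<close> u])
  then obtain k where k: "\<And>l. l \<in> {1..N} \<Longrightarrow> k l \<in> {1..J}"
    "\<And>l j. l \<in> {1..N} \<Longrightarrow> j \<in> {1..J} \<Longrightarrow> u l \<in> bin J j \<longleftrightarrow> j = k l"
    "\<And>l. l \<in> {1..N} \<Longrightarrow> \<bar>u l - mid (k l)\<bar> \<le> 1 / (2 * real J)"
    by blast
  have q: "q j = (\<Sum>l=1..N. if k l = j then 1 else 0) / real N" if "j \<in> {1..J}" for j
  proof -
    have "{l \<in> {1..N}. u l \<in> bin J j} = {l \<in> {1..N}. k l = j}"
      using k(2) that by auto
    thus ?thesis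
      by (simp add: q_def bin_freq_def bin_count_def sum.If_cases Int_def)
  qed
  have q_sum: "(\<Sum>j=1..J. q j * g j) = (\<Sum>l=1..N. g (k l)) / real N" for g :: "nat \<Rightarrow> real"
  proof -
    have "(\<Sum>j=1..J. q j * g j) = (\<Sum>j=1..J. \<Sum>l=1..N. if k l = j then g j else 0) / real N"
      by (simp add: q sum_distrib_right sum_divide_distrib if_distrib[where f = "\<lambda>x. x * _"] cong: if_cong)
    also have "(\<Sum>j=1..J. \<Sum>l=1..N. if k l = j then g j else 0) = (\<Sum>l=1..N. \<Sum>j=1..J. if k l = j then g j else 0)"
      by (rule sum.swap)
    also have "\<dots> = (\<Sum>l=1..N. g (k l))"
      using k(1) by (intro sum.cong) (auto simp: sum.delta)
    finally show ?thesis .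
  qed
  have q0: "q j \<ge> 0" for j by (simp add: q_def bin_freq_def)
  have q1: "(\<Sum>j=1..J. q j) = 1" using q_sum[of "\<lambda>_. 1"] N by simp
  have kl: "kl_vec J q (\<lambda>_. 1 / real J) = (\<Sum>j=1..J. q j * ln (q j / (1 / real J)))"
    using J q0 by (intro kl_vec_eq_sum) auto
  have mid01: "mid j \<in> {0..1}" if "j \<in> {1..J}" for j
    using that J by (auto simp: mid_def field_simps)
  have mean: "(\<Sum>j=1..J. mid j) / real J = 1 / 2"
  proof -
    have "(\<Sum>j=1..n. real j - 1 / 2) = (real n)\<^sup>2 / 2" for n
      by (induction n) (auto simp: power2_eq_square algebra_simps)
    thus ?thesis
      using J by (simp add: mid_def sum_divide_distrib[symmetric] power2_eq_square)
  qed
  have dev: "2 * ((\<Sum>j=1..J. q j * mid j) - 1 / 2)\<^sup>2 \<le> kl_vec J q (\<lambda>_. 1 / real J)"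
    unfolding kl mean[symmetric]
    using weighted_mean_deviation_le_KL[of J q mid] \<open>J \<ge> 1\<close> q0 q1 mid01 by blast
  have "\<bar>(\<Sum>j=1..J. q j * mid j) - 1 / 2\<bar> \<le> sqrt (kl_vec J q (\<lambda>_. 1 / real J) / 2)"
    using dev by (intro real_le_rsqrt) simp
  moreover have "\<bar>(\<Sum>l=1..N. u l) / real N - (\<Sum>j=1..J. q j * mid j)\<bar> \<le> 1 / (2 * real J)"
  proof -
    have "\<bar>\<Sum>l=1..N. u l - mid (k l)\<bar> \<le> real (card {1..N}) * (1 / (2 * real J))"
      by (rule order_trans[OF sum_abs sum_bounded_above]) (rule k(3))
    hence "\<bar>\<Sum>l=1..N. u l - mid (k l)\<bar> / real N \<le> 1 / (2 * real J)"
      using N by (simp add: field_simps)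
    thus ?thesis
      using N unfolding q_sum diff_divide_distrib[symmetric] sum_subtractf[symmetric]
      by (simp add: abs_divide)
  qed
  ultimately show "\<bar>(\<Sum>l=1..N. u l) / real N - 1 / 2\<bar>
           \<le> 1 / (2 * real J) + sqrt (kl_vec J (bin_freq J N u) (\<lambda>_. 1 / real J) / 2)"
    unfolding q_def[symmetric] by linarith
qed

section \<open>The restarted component and paths without detection\<close>

lemma kt_density_pos:
  assumes "J \<ge> 1" and "s < t"
  shows "kt_density J p s t u > 0"
proof -
  have "real s + 1 \<le> real t" using \<open>s < t\<close> by simp
  thus ?thesis
    using \<open>J \<ge> 1\<close> unfolding kt_density_def by (intro mult_pos_pos divide_pos_pos) auto
qed

lemma kt_component_pos: "J \<ge> 1 \<Longrightarrow> kt_component J p s t > 0"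
  unfolding kt_component_def by (auto intro!: prod_pos kt_density_pos)

lemma kt_component_eq_kt_block:
  assumes "m \<ge> 1"
  shows "kt_component J p \<tau> (\<tau> + m) = kt_block J m (\<lambda>l. p (\<tau> + l))"
proof -
  have count: "bin_count J p \<tau> j (\<tau> + l) = bin_count J (\<lambda>l. p (\<tau> + l)) 0 j l" for j l
    unfolding bin_count_def
    by (rule bij_betw_same_card[of "\<lambda>i. i - \<tau>"], rule bij_betwI[where g = "\<lambda>i. \<tau> + i"]) auto
  have "kt_component J p \<tau> (\<tau> + m) = (\<Prod>i=\<tau>+1..\<tau>+m. kt_density J p \<tau> i (p i))"
    using assms by (simp add: kt_component_def)
  also have "\<dots> = (\<Prod>l=1..m. kt_density J p \<tau> (\<tau> + l) (p (\<tau> + l)))"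
    by (rule prod.reindex_bij_witness[of _ "\<lambda>k. \<tau> + k" "\<lambda>t. t - \<tau>"]) auto
  also have "\<dots> = kt_block J m (\<lambda>l. p (\<tau> + l))"
    unfolding kt_block_def
  proof (intro prod.cong refl)
    fix l assume "l \<in> {1..m}"
    \<comment> \<open>Writing \<open>l = Suc l'\<close> turns the index
      \<open>\<tau> + l - 1\<close> into \<open>\<tau> + l'\<close>, to which \<open>count\<close>
      applies.\<close>
    then obtain l' where l: "l = Suc l'" by (cases l) auto
    show "kt_density J p \<tau> (\<tau> + l) (p (\<tau> + l)) = real J *
        ((real (bin_count J (\<lambda>l. p (\<tau> + l)) 0 (bin_index J (p (\<tau> + l))) (l - 1)) + 1 / 2)
          / (real l - 1 + real J / 2))"
      using count[of _ l'] by (simp add: kt_density_def l)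
  qed
  finally show ?thesis .
qed

lemma restart_mixture_ge_component:
  assumes "J \<ge> 1" and "\<And>s. \<pi> s \<ge> 0" and "summable \<pi>"
  shows "\<pi> \<tau> * kt_component J p \<tau> t \<le> restart_mixture J \<pi> p t"
proof -
  have "summable (\<lambda>s. \<pi> s * kt_component J p s t)"
  proof -
    \<comment> \<open>Components restarted at or after \<open>t\<close> equal 1, so the tail of the
      series is that of the weights.\<close>
    have "eventually (\<lambda>s. \<pi> s * kt_component J p s t = \<pi> s) sequentially"
      using eventually_ge_at_top[of t] by eventually_elim (simp add: kt_component_def)
    from summable_cong[OF this] show ?thesis using \<open>summable \<pi>\<close> by simp
  qed
  from sum_le_suminf[OF this, of "{\<tau>}"] assms kt_component_pos[OF \<open>J \<ge> 1\<close>, of p _ t]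
  show ?thesis by (simp add: restart_mixture_def less_imp_le)
qed

text \<open>Pathwise part of the argument: the regret bound is read backwards, as an upper bound on
  the relative entropy once the threshold limits the KT product.\<close>

lemma no_detection_mean:
  assumes J: "J \<ge> 1" and "m \<ge> 1"
    and \<pi>: "\<And>s. \<pi> s \<ge> 0" "summable \<pi>" "\<pi> \<tau> > 0"
    and B: "B (\<tau> + m) > 0" and C: "kt_regret_constant J C"
    and p: "\<And>t. t \<in> {\<tau>+1..\<tau>+m} \<Longrightarrow> p t \<in> {0..1}"
    and late: "restart_delay J \<pi> B p > enat (\<tau> + m)"
  shows "\<bar>(\<Sum>t=\<tau>+1..\<tau>+m. p t) / real m - 1 / 2\<bar>
           \<le> 1 / (2 * real J) + sqrt (pos_part (restart_threshold J C \<pi> B \<tau> m) / (2 * real m))"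
proof -
  define u where "u l = p (\<tau> + l)" for l
  define KL where "KL = kl_vec J (bin_freq J m u) (\<lambda>_. 1 / real J)"
  have u: "u l \<in> {0..1}" if "l \<in> {1..m}" for l
    using p[of "\<tau> + l"] that by (simp add: u_def)
  have block: "kt_component J p \<tau> (\<tau> + m) = kt_block J m u"
    unfolding u_def by (rule kt_component_eq_kt_block[OF \<open>m \<ge> 1\<close>])
  hence pos: "kt_block J m u > 0"
    using kt_component_pos[OF J, of p \<tau> "\<tau> + m"] by simp
  \<comment> \<open>Only the time \<open>\<tau> + m\<close> itself is used: a crossing there would
    put it into the set whose infimum is the delay.\<close>
  have "\<not> restart_mixture J \<pi> p (\<tau> + m) > B (\<tau> + m)"
  proof
    assume "restart_mixture J \<pi> p (\<tau> + m) > B (\<tau> + m)"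
    hence "restart_delay J \<pi> B p \<le> enat (\<tau> + m)"
      unfolding restart_delay_def using \<open>m \<ge> 1\<close> by (intro Inf_lower) auto
    thus False using late by simp
  qed
  hence "\<pi> \<tau> * kt_block J m u \<le> B (\<tau> + m)"
    using restart_mixture_ge_component[OF J \<pi>(1,2), of \<tau> p "\<tau> + m"] block by simp
  hence "ln (\<pi> \<tau> * kt_block J m u) \<le> ln (B (\<tau> + m))"
    using pos \<pi>(3) B by (subst ln_le_cancel_iff) auto
  hence "ln (kt_block J m u) \<le> ln (B (\<tau> + m)) + ln (1 / \<pi> \<tau>)"
    using pos \<pi>(3) by (simp add: ln_mult ln_div)
  moreover have "ln (kt_block J m u) \<ge> real m * KL - (real J - 1) / 2 * ln (real m + 1) - C"
    using C \<open>m \<ge> 1\<close> u unfolding kt_regret_constant_def KL_def by blast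
  ultimately have "real m * KL \<le> restart_threshold J C \<pi> B \<tau> m"
    unfolding restart_threshold_def by linarith
  also have "\<dots> \<le> pos_part (restart_threshold J C \<pi> B \<tau> m)"
    by (simp add: pos_part_def)
  finally have "KL / 2 \<le> pos_part (restart_threshold J C \<pi> B \<tau> m) / (2 * real m)"
    using \<open>m \<ge> 1\<close> by (simp add: field_simps)
  hence "sqrt (KL / 2) \<le> sqrt (pos_part (restart_threshold J C \<pi> B \<tau> m) / (2 * real m))"
    by simp
  moreover have reindex: "(\<Sum>t=\<tau>+1..\<tau>+m. p t) = (\<Sum>l=1..m. u l)"
    unfolding u_def by (rule sum.reindex_bij_witness[of _ "\<lambda>k. \<tau> + k" "\<lambda>t. t - \<tau>"]) auto
  moreover have "\<bar>(\<Sum>l=1..m. u l) / real m - 1 / 2\<bar> \<le> 1 / (2 * real J) + sqrt (KL / 2)"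
    unfolding KL_def using J \<open>m \<ge> 1\<close> u by (rule block_mean_deviation_le_KL)
  ultimately show ?thesis
    unfolding reindex by linarith
qed

text \<open>Stated for arbitrary subsets \<open>A\<close> of the event: the event is not shown to be measurable, so
  monotonicity of the measure cannot be applied to it afterwards.\<close>

lemma (in change_point_model) prob_no_detection_le:
  assumes "\<tau> \<ge> 1" and J: "J \<ge> 1" and m: "m \<ge> 1"
    and F1: "continuous_distribution F1"
    and \<Delta>: "\<Delta> = \<bar>prob_greater F0 F1 - 1 / 2\<bar>"
    and \<pi>: "\<And>s. \<pi> s \<ge> 0" "summable \<pi>" "\<pi> \<tau> > 0"
    and B: "B (\<tau> + m) > 0" and C: "kt_regret_constant J C"
    and A: "A \<subseteq> {\<omega> \<in> space M. restart_delay J \<pi> B (conformal_p X U \<omega>) > enat (\<tau> + m)}"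
  shows "prob A \<le> delay_bound J C \<pi> B \<Delta> \<tau> m"
proof -
  define r where "r = 1 / (2 * real J) + sqrt (pos_part (restart_threshold J C \<pi> B \<tau> m) / (2 * real m))"
  define x where "x = \<Delta> * dilution \<tau> m - r"
  have bound: "delay_bound J C \<pi> B \<Delta> \<tau> m = exp (- (2 * real m / 7) * (pos_part x)\<^sup>2)"
    by (simp add: delay_bound_def x_def r_def algebra_simps)
  show ?thesis
  proof (cases "x > 0")
    \<comment> \<open>The positive part vanishes and the bound is \<open>exp 0 = 1\<close>.\<close>
    case False
    thus ?thesis by (simp add: bound pos_part_def)
  next
    case True
    define \<theta> where "\<theta> = prob_greater F0 F1"
    \<comment> \<open>If \<theta> is at least 1/2, the expected mean is at least 1/2, so an observed
      mean near 1/2 is a downward deviation. In both cases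
      \<open>\<sigma> * (\<theta> - 1 / 2) = - \<Delta>\<close>.\<close>
    define \<sigma> :: real where "\<sigma> = (if \<theta> \<ge> 1 / 2 then -1 else 1)"
    have "prob A \<le> exp (- 2 * (real m * x)\<^sup>2 / (7 * real m))"
    proof (rule post_change_sum_tail[where \<sigma> = \<sigma>])
      fix \<omega> assume \<omega>: "\<omega> \<in> A" and U: "\<And>t. t \<in> {\<tau>+1..\<tau>+m} \<Longrightarrow> U t \<omega> \<in> {0..1}"
      define S where "S = (\<Sum>t=\<tau>+1..\<tau>+m. conformal_p X U \<omega> t)"
      have "\<bar>S / real m - 1 / 2\<bar> \<le> r"
        unfolding S_def r_def
        using A \<omega> U by (intro no_detection_mean J m \<pi> B C conformal_p_in_unit_interval) auto
      moreover have "\<sigma> * (S / real m - (1 / 2 + (\<theta> - 1 / 2) * dilution \<tau> m))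
          = \<sigma> * (S / real m - 1 / 2) + \<Delta> * dilution \<tau> m"
        by (simp add: \<sigma>_def \<Delta> \<theta>_def algebra_simps)
      moreover have "\<sigma> * y \<ge> - \<bar>y\<bar>" for y
        by (auto simp: \<sigma>_def)
      note this[of "S / real m - 1 / 2"]
      ultimately have "x \<le> \<sigma> * (S / real m - (1 / 2 + (\<theta> - 1 / 2) * dilution \<tau> m))"
        by (simp add: x_def)
      hence "real m * x \<le> real m * (\<sigma> * (S / real m - (1 / 2 + (\<theta> - 1 / 2) * dilution \<tau> m)))"
        by (rule mult_left_mono) simp
      also have "\<dots> = \<sigma> * (S - real m * (1 / 2 + (\<theta> - 1 / 2) * dilution \<tau> m))"
        using m by (simp add: field_simps)
      finally show "\<sigma> * ((\<Sum>t=\<tau>+1..\<tau>+m. conformal_p X U \<omega> t)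
           - real m * (1 / 2 + (prob_greater F0 F1 - 1 / 2) * dilution \<tau> m)) \<ge> real m * x"
        unfolding S_def \<theta>_def .
    next
      show "\<bar>\<sigma>\<bar> = 1" by (simp add: \<sigma>_def)
      show "\<omega> \<in> space M" if "\<omega> \<in> A" for \<omega> using A that by auto
    qed (use assms True in auto)
    also have "- 2 * (real m * x)\<^sup>2 / (7 * real m) = - (2 * real m / 7) * (pos_part x)\<^sup>2"
      using m True by (simp add: pos_part_def power2_eq_square field_simps)
    finally show ?thesis by (simp add: bound)
  qed
qed

theorem theorem4p4:
  fixes M :: "'a measure" and X U :: "nat \<Rightarrow> 'a \<Rightarrow> real" and F0 F1 :: "real measure"
    and \<tau> J :: nat and \<pi> B :: "nat \<Rightarrow> real" and C \<theta> \<Delta> :: real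
  assumes "\<tau> \<ge> 1" and "J \<ge> 2"
    and "continuous_distribution F0" and "continuous_distribution F1"
    and "change_point_model M X U F0 F1 \<tau>"
    and "\<theta> = prob_greater F0 F1" and "\<Delta> = \<bar>\<theta> - 1/2\<bar>" and "\<Delta> > 0"
    and "\<And>s. \<pi> s \<ge> 0" and "\<pi> sums 1" and "\<pi> \<tau> > 0"
    and "\<And>t. t \<ge> 1 \<Longrightarrow> B t > 0"
    and "kt_regret_constant J C"
  shows "(\<forall>m\<ge>1. \<P>(\<omega> in M. restart_delay J \<pi> B (conformal_p X U \<omega>) > enat (\<tau> + m))
                 \<le> delay_bound J C \<pi> B \<Delta> \<tau> m)
       \<and> (\<forall>n\<ge>1. \<P>(\<omega> in M. restart_delay J \<pi> B (conformal_p X U \<omega>) > enat (\<tau> + n))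
                 \<le> (INF m\<in>{1..n}. delay_bound J C \<pi> B \<Delta> \<tau> m))"
proof -
  interpret change_point_model M X U F0 F1 \<tau> by fact
  have main: "\<P>(\<omega> in M. restart_delay J \<pi> B (conformal_p X U \<omega>) > enat (\<tau> + n))
      \<le> delay_bound J C \<pi> B \<Delta> \<tau> m" if "m \<in> {1..n}" for m n
  proof (rule prob_no_detection_le)
    have "enat (\<tau> + m) \<le> enat (\<tau> + n)" using that by simp
    thus "{\<omega> \<in> space M. restart_delay J \<pi> B (conformal_p X U \<omega>) > enat (\<tau> + n)}
        \<subseteq> {\<omega> \<in> space M. restart_delay J \<pi> B (conformal_p X U \<omega>) > enat (\<tau> + m)}"
      by (blast intro: le_less_trans)
  qed (use assms that in \<open>auto simp: sums_iff\<close>)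
  show ?thesis
    by (auto intro!: main cINF_greatest)
qed

end
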